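(* Fix $p\ge3$ and let $(\beta,h)\in\Theta$ be $p$-regular, with $\beta$ known and $\bm X\sim\mathbb P_{\beta,h,p}$. Let $m_*$ be the unique global maximizer of $H=H_{\beta,h,p}$. Then as $N\to\infty$, $N^{1/2}(\hat h_N-h)\to N(0,-H''(m_* ))$ in distribution.
   Context: The $p$-tensor Curie–Weiss model on $\{-1,1\}^N$: $\mathbb P_{\beta,h,p}(\bm X)=\frac{1}{2^NZ_N(\beta,h,p)}\exp\{N(\beta\bar X_N^p+h\bar X_N)\}$ with $\bar X_N=N^{-1}\sum_iX_i$, for $(\beta,h)\in\mathbb R^2$; $\Theta=[0,\infty)\times\mathbb R$. $\mathbb E_{\beta,h,p}$ denotes expectation under it. $I(x)=\frac12[(1+x)\log(1+x)+(1-x)\log(1-x)]$, $H_{\beta,h,p}(x)=\beta x^p+hx-I(x)$ on $[-1,1]$. $(\beta,h)$ is $p$-regular if $H_{\beta,h,p}$ has a unique global maximizer $m_*\in(-1,1)$ with $H''(m_* )<0$. For known $\beta$, the maximum likelihood estimate $\hat h_N\in[-\infty,\infty]$ is the maximizer of the likelihood over $h\in\mathbb R$, equivalently the solution in $h$ of $\mathbb E_{\beta,h,p}(\bar X_N)=\bar X_N$. *)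

theory Defs
  imports "HOL-Probability.Probability"
begin

definition cw_conf :: "nat \<Rightarrow> int list set" where
  "cw_conf N = {xs. length xs = N \<and> set xs \<subseteq> {-1, 1}}"

definition cw_mag :: "int list \<Rightarrow> real" where
  "cw_mag xs = real_of_int (sum_list xs) / real (length xs)"

definition cw_weight :: "nat \<Rightarrow> real \<Rightarrow> real \<Rightarrow> nat \<Rightarrow> int list \<Rightarrow> real" where
  "cw_weight N \<beta> h p xs = exp (real N * (\<beta> * cw_mag xs ^ p + h * cw_mag xs))"

definition cw_Z :: "nat \<Rightarrow> real \<Rightarrow> real \<Rightarrow> nat \<Rightarrow> real" where
  "cw_Z N \<beta> h p = (\<Sum>ys\<in>cw_conf N. cw_weight N \<beta> h p ys) / 2 ^ N"

definition cw_pmf :: "nat \<Rightarrow> real \<Rightarrow> real \<Rightarrow> nat \<Rightarrow> int list pmf" where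
  "cw_pmf N \<beta> h p = embed_pmf (\<lambda>xs. if xs \<in> cw_conf N
       then cw_weight N \<beta> h p xs / (2 ^ N * cw_Z N \<beta> h p) else 0)"

definition cw_I :: "real \<Rightarrow> real" where
  "cw_I x = ((1 + x) * ln (1 + x) + (1 - x) * ln (1 - x)) / 2"

definition cw_H :: "real \<Rightarrow> real \<Rightarrow> nat \<Rightarrow> real \<Rightarrow> real" where
  "cw_H \<beta> h p x = \<beta> * x ^ p + h * x - cw_I x"

definition cw_regular :: "real \<Rightarrow> real \<Rightarrow> nat \<Rightarrow> bool" where
  "cw_regular \<beta> h p \<longleftrightarrow> (\<exists>m. m \<in> {-1<..<1}
      \<and> (\<forall>x\<in>{-1..1}. x \<noteq> m \<longrightarrow> cw_H \<beta> h p x < cw_H \<beta> h p m)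
      \<and> deriv (deriv (cw_H \<beta> h p)) m < 0)"

(* MLE of h for known \<beta>, in [-\<infinity>,\<infinity>]: the maximiser over h \<in> \<real> of the likelihood
   when it exists; otherwise (|mean| = 1, likelihood monotone in h) the
   supremum is attained at +\<infinity> resp. -\<infinity>. *)
definition cw_mle :: "nat \<Rightarrow> real \<Rightarrow> nat \<Rightarrow> int list \<Rightarrow> ereal" where
  "cw_mle N \<beta> p xs =
     (if \<exists>!h. is_arg_max (\<lambda>h. pmf (cw_pmf N \<beta> h p) xs) (\<lambda>_. True) h
      then ereal (THE h. is_arg_max (\<lambda>h. pmf (cw_pmf N \<beta> h p) xs) (\<lambda>_. True) h)
      else if cw_mag xs > 0 then \<infinity> else -\<infinity>)"

end

theory Submission
  imports Defs "HOL-Real_Asymp.Real_Asymp"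
begin

text \<open>
  Write \<open>W = sqrt N * (mean - m)\<close> and \<open>a = - H''(m)\<close>. Since \<open>H'(m) = 0\<close>, the model with field
  \<open>h + s / sqrt N\<close> has, up to normalisation, the density \<open>exp (N * \<beta> * R + s * W)\<close> with respect to
  independent spins of mean \<open>m\<close>, where \<open>R\<close> is the second order Taylor remainder of the \<open>p\<close>-th power at \<open>m\<close>.
  The central limit theorem for independent spins thus yields a Gaussian limit with mean \<open>s / a\<close> and
  variance \<open>1 / a\<close>, provided that the densities are uniformly integrable. This follows from
  \<open>\<beta> * R \<le> l * D - c * (x - m)^2\<close> with \<open>l < 1\<close>, \<open>D\<close> the relative entropy, as Chernoff's bound makes
  \<open>exp (l * N * D)\<close> bounded in expectation. In particular \<open>W\<close> is asymptotically \<open>N(0, 1/a)\<close> at field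
  \<open>h\<close>, and its expectation at field \<open>h + x / sqrt N\<close> tends to \<open>x / a\<close>. The estimate is at most
  \<open>h + x / sqrt N\<close> iff the observed mean is at most the expected mean at that field, so the
  probability of this event tends to \<open>P(N(0, 1/a) \<le> x / a) = P(N(0, a) \<le> x)\<close>.
\<close>

section \<open>Quadratic bounds at the maximiser\<close>

text \<open>The value \<open>l = 1\<close> is out of reach: a value \<open>x\<close> of the mean has
  probability about \<open>exp (- N * D)\<close> up to polynomial factors, so
  \<open>exp (N * D)\<close> has expectation of order \<open>sqrt N\<close>. The strict maximum
  alone yields only \<open>\<beta> * R < D\<close> away from \<open>m\<close>, which is this
  borderline case. The condition \<open>H''(m) < 0\<close> adds a quadratic gap; since
  \<open>D\<close> is itself at most a multiple of \<open>(x - m)^2\<close>, half of the gap pays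
  for lowering \<open>l\<close> below 1, and the other half controls the linear term
  \<open>s * W\<close> and the growth of the test function. The densities depend on \<open>N\<close>
  and must converge together with \<open>W\<close>; almost sure representatives of the weak limit
  allow this. One limit theorem, for test functions bounded by \<open>exp\<close> of the absolute
  value and with finitely many discontinuities, serves three times: with the constant 1 for the
  normalisation, the identity for the mean and an indicator for the distribution function. The
  constants in front of the Gaussian integrals then cancel in quotients and need not be matched with
  \<open>cw_Z\<close>.\<close>

lemma tendsto_quotient_square:
  fixes f f' :: "real \<Rightarrow> real"
  assumes "\<forall>\<^sub>F x in nhds m. (f has_real_derivative f' x) (at x)"
    and "(f' has_real_derivative c) (at m)" and "f m = 0" and "f' m = 0"
  shows "((\<lambda>x. f x / (x - m)\<^sup>2) \<longlongrightarrow> c / 2) (at m)"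
proof (rule lhopital[where f' = f' and g' = "\<lambda>x. 2 * (x - m)"])
  have "isCont f m"
    using eventually_nhds_x_imp_x[OF assms(1)] by (rule DERIV_isCont)
  then show "(f \<longlongrightarrow> 0) (at m)"
    using assms(3) by (simp add: isCont_def)
  have "((\<lambda>x. (x - m)\<^sup>2) \<longlongrightarrow> (m - m)\<^sup>2) (at m)"
    by (intro tendsto_intros)
  then show "((\<lambda>x. (x - m)\<^sup>2) \<longlongrightarrow> 0) (at m)" by simp
  show "\<forall>\<^sub>F x in at m. (x - m)\<^sup>2 \<noteq> 0" "\<forall>\<^sub>F x in at m. 2 * (x - m) \<noteq> 0"
    by (auto simp: eventually_at_filter)
  show "\<forall>\<^sub>F x in at m. (f has_real_derivative f' x) (at x)"
    using assms(1) unfolding eventually_at_filter by (rule eventually_mono) simp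
  show "\<forall>\<^sub>F x in at m. ((\<lambda>x. (x - m)\<^sup>2) has_real_derivative 2 * (x - m)) (at x)"
    by (auto intro!: derivative_eq_intros always_eventually)
  \<comment> \<open>After one use of l'Hopital the quotient is half the difference quotient of
    \<open>f'\<close>, so \<open>f'\<close> need be differentiable only at the point
    \<open>m\<close> itself.\<close>
  have "((\<lambda>x. (f' x - f' m) / (x - m) / 2) \<longlongrightarrow> c / 2) (at m)"
    using assms(2) unfolding has_field_derivative_iff by (intro tendsto_divide) auto
  then show "((\<lambda>x. f' x / (2 * (x - m))) \<longlongrightarrow> c / 2) (at m)"
    using assms(4) by (simp add: mult.commute)
qed

text \<open>The singularity at \<open>m\<close> is removable. On a compact set the extended quotient
  is bounded and attains its maximum, which is how a limit at one point becomes a bound on all of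
  \<open>{-1..1}\<close>.\<close>

lemma continuous_on_quotient_square:
  fixes f :: "real \<Rightarrow> real"
  assumes "continuous_on S f" and "((\<lambda>x. f x / (x - m)\<^sup>2) \<longlongrightarrow> L) (at m)"
  shows "continuous_on S (\<lambda>x. if x = m then L else f x / (x - m)\<^sup>2)"
  unfolding continuous_on_def
proof
  fix y assume "y \<in> S"
  show "((\<lambda>x. if x = m then L else f x / (x - m)\<^sup>2) \<longlongrightarrow> (if y = m then L else f y / (y - m)\<^sup>2)) (at y within S)"
  proof (cases "y = m")
    case True
    have "((\<lambda>x. f x / (x - m)\<^sup>2) \<longlongrightarrow> L) (at m within S)"
      using assms(2) by (rule filterlim_mono) (auto intro: at_le)
    then have "((\<lambda>x. if x = m then L else f x / (x - m)\<^sup>2) \<longlongrightarrow> L) (at m within S)"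
      by (rule Lim_transform_eventually) (auto simp: eventually_at_filter)
    with True show ?thesis by simp
  next
    case False
    have "(f \<longlongrightarrow> f y) (at y within S)"
      using assms(1) \<open>y \<in> S\<close> by (auto simp: continuous_on_def)
    then have "((\<lambda>x. f x / (x - m)\<^sup>2) \<longlongrightarrow> f y / (y - m)\<^sup>2) (at y within S)"
      using False by (intro tendsto_intros) auto
    moreover have "\<forall>\<^sub>F x in at y within S. f x / (x - m)\<^sup>2 = (if x = m then L else f x / (x - m)\<^sup>2)"
      using False by (intro eventually_mono[OF eventually_neq_at_within[of m y S]]) simp
    ultimately show ?thesis
      using False by (simp add: Lim_transform_eventually)
  qed
qed

lemma quadratic_upper_bound:
  fixes f :: "real \<Rightarrow> real"
  assumes "compact S" and "continuous_on S f" and "f m = 0"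
    and "((\<lambda>x. f x / (x - m)\<^sup>2) \<longlongrightarrow> L) (at m)"
  shows "\<exists>C>0. \<forall>x\<in>S. f x \<le> C * (x - m)\<^sup>2"
proof -
  let ?q = "\<lambda>x. if x = m then L else f x / (x - m)\<^sup>2"
  have "bounded (?q ` S)"
    using compact_continuous_image[OF continuous_on_quotient_square[OF assms(2,4)] assms(1)]
    by (rule compact_imp_bounded)
  then obtain C where "C > 0" and C: "\<And>x. x \<in> S \<Longrightarrow> \<bar>?q x\<bar> \<le> C"
    unfolding bounded_pos by auto
  have "f x \<le> C * (x - m)\<^sup>2" if "x \<in> S" for x
    using C[OF that] assms(3) by (auto simp: field_simps split: if_splits)
  with \<open>C > 0\<close> show ?thesis by blast
qed

lemma quadratic_upper_bound_neg:
  fixes f :: "real \<Rightarrow> real"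
  assumes "compact S" and "m \<in> S" and "continuous_on S f" and "f m = 0"
    and "((\<lambda>x. f x / (x - m)\<^sup>2) \<longlongrightarrow> L) (at m)"
    and "L < 0" and "\<And>x. x \<in> S \<Longrightarrow> x \<noteq> m \<Longrightarrow> f x < 0"
  shows "\<exists>c>0. \<forall>x\<in>S. f x \<le> - c * (x - m)\<^sup>2"
proof -
  let ?q = "\<lambda>x. if x = m then L else f x / (x - m)\<^sup>2"
  \<comment> \<open>The maximum of the extended quotient is negative wherever it is attained: at
    \<open>m\<close> by the sign of \<open>L\<close>, elsewhere by the sign of \<open>f\<close>. Its
    negative is the constant sought.\<close>
  obtain z where z: "z \<in> S" "\<And>x. x \<in> S \<Longrightarrow> ?q x \<le> ?q z"
    using continuous_attains_sup[OF assms(1) _ continuous_on_quotient_square[OF assms(3,5)]] assms(2)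
    by blast
  have "?q z < 0"
    using assms(6,7) z(1) by (auto simp: divide_less_0_iff)
  moreover have "f x \<le> ?q z * (x - m)\<^sup>2" if "x \<in> S" for x
    using z(2)[OF that] assms(4) by (auto simp: field_simps split: if_splits)
  ultimately show ?thesis
    by (intro exI[of _ "- ?q z"]) auto
qed

section \<open>Continuity and derivatives of the entropy and of \<open>cw_H\<close>\<close>

lemma tendsto_mult_self_ln: "((\<lambda>x::real. x * ln x) \<longlongrightarrow> 0) (at_right 0)"
  by real_asymp

text \<open>The value at 0 is 0 because of the factor 0, and this agrees with the limit. Hence
  \<open>cw_I\<close> is continuous up to -1 and 1, the means of the constant
  configurations.\<close>

lemma continuous_on_mult_self_ln: "continuous_on {0..} (\<lambda>x::real. x * ln x)"
  unfolding continuous_on_def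
proof
  fix y :: real assume y: "y \<in> {0..}"
  show "((\<lambda>x. x * ln x) \<longlongrightarrow> y * ln y) (at y within {0..})"
  proof (cases "y = 0")
    case True
    have "((\<lambda>x::real. x * ln x) \<longlongrightarrow> 0) (at 0 within {0..})"
      using tendsto_mult_self_ln by (simp add: at_within_Ici_at_right)
    with True show ?thesis by simp
  next
    case False
    with y show ?thesis by (intro tendsto_intros) auto
  qed
qed

lemma continuous_on_cw_I: "continuous_on {-1..1} cw_I"
proof -
  have "continuous_on {-1..1} (\<lambda>x::real. (1 + x) * ln (1 + x))"
    by (rule continuous_on_compose2[OF continuous_on_mult_self_ln]) (auto intro!: continuous_intros)
  moreover have "continuous_on {-1..1} (\<lambda>x::real. (1 - x) * ln (1 - x))"
    by (rule continuous_on_compose2[OF continuous_on_mult_self_ln]) (auto intro!: continuous_intros)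
  ultimately show ?thesis
    unfolding cw_I_def by (intro continuous_on_divide continuous_on_add continuous_on_const) auto
qed

lemma artanh_ln: "\<bar>x\<bar> < 1 \<Longrightarrow> artanh x = (ln (1 + x) - ln (1 - x)) / 2" for x :: real
  by (simp add: artanh_def ln_div abs_less_iff)

lemma artanh_strict_mono: "- 1 < x \<Longrightarrow> x < y \<Longrightarrow> y < 1 \<Longrightarrow> artanh x < artanh y" for x y :: real
  by (subst (1 2) artanh_ln) (auto simp: abs_less_iff intro!: divide_strict_right_mono diff_strict_mono)

lemma has_real_derivative_cw_I: "\<bar>x\<bar> < 1 \<Longrightarrow> (cw_I has_real_derivative artanh x) (at x)"
  unfolding cw_I_def [abs_def] artanh_ln
  by (auto intro!: derivative_eq_intros simp: abs_less_iff)

text \<open>This is the Legendre form of \<open>cw_I\<close>: at \<open>t = artanh x\<close>, the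
  term \<open>ln (1 - x\<^sup>2) / 2\<close> equals \<open>- ln (cosh t)\<close>. It matches the
  exponents of \<open>pmf_spin_pmf_exp\<close>.\<close>

lemma cw_I_artanh: "\<bar>x\<bar> < 1 \<Longrightarrow> cw_I x = artanh x * x + ln (1 - x\<^sup>2) / 2"
proof -
  assume x: "\<bar>x\<bar> < 1"
  have "ln (1 - x\<^sup>2) = ln ((1 + x) * (1 - x))"
    by (simp add: algebra_simps power2_eq_square)
  also have "\<dots> = ln (1 + x) + ln (1 - x)"
    using x by (subst ln_mult) (auto simp: abs_less_iff)
  finally show ?thesis
    using x by (simp add: cw_I_def artanh_ln field_simps)
qed

lemma has_real_derivative_cw_H:
  "\<bar>x\<bar> < 1 \<Longrightarrow> (cw_H \<beta> h p has_real_derivative \<beta> * (real p * x ^ (p - 1)) + h - artanh x) (at x)"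
  unfolding cw_H_def[abs_def]
  by (auto intro!: derivative_eq_intros has_real_derivative_cw_I)

lemma has_real_derivative_cw_H':
  "\<bar>x\<bar> < 1 \<Longrightarrow> ((\<lambda>x. \<beta> * (real p * x ^ (p - 1)) + h - artanh x) has_real_derivative
      \<beta> * (real p * (real (p - 1) * x ^ (p - 2))) - 1 / (1 - x\<^sup>2)) (at x)"
  by (auto intro!: derivative_eq_intros simp: numeral_2_eq_2)

lemma eventually_abs_less_1: "\<bar>m\<bar> < 1 \<Longrightarrow> \<forall>\<^sub>F x in nhds m. \<bar>x\<bar> < 1" for m :: real
  using eventually_nhds_in_open[of "{-1<..<1}" m]
  by (auto simp: abs_less_iff elim: eventually_mono)

lemma deriv_deriv_cw_H:
  assumes "\<bar>x\<bar> < 1"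
  shows "deriv (deriv (cw_H \<beta> h p)) x = \<beta> * (real p * (real (p - 1) * x ^ (p - 2))) - 1 / (1 - x\<^sup>2)"
proof -
  have "deriv (deriv (cw_H \<beta> h p)) x = deriv (\<lambda>x. \<beta> * (real p * x ^ (p - 1)) + h - artanh x) x"
    by (intro deriv_cong_ev eventually_mono[OF eventually_abs_less_1[OF assms]]
        DERIV_imp_deriv has_real_derivative_cw_H refl)
  also have "\<dots> = \<beta> * (real p * (real (p - 1) * x ^ (p - 2))) - 1 / (1 - x\<^sup>2)"
    by (intro DERIV_imp_deriv has_real_derivative_cw_H' assms)
  finally show ?thesis .
qed

text \<open>The relative entropy of a single spin of mean \<open>x\<close> with respect to one of mean \<open>m\<close>.\<close>

definition cw_D :: "real \<Rightarrow> real \<Rightarrow> real" where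
  "cw_D m x = cw_I x - cw_I m - artanh m * (x - m)"

definition power_remainder :: "nat \<Rightarrow> real \<Rightarrow> real \<Rightarrow> real" where
  "power_remainder p m x = x ^ p - m ^ p - real p * m ^ (p - 1) * (x - m)"

lemma cw_D_self [simp]: "cw_D m m = 0"
  by (simp add: cw_D_def)

lemma continuous_on_cw_D: "continuous_on {-1..1} (cw_D m)"
  unfolding cw_D_def by (intro continuous_intros continuous_on_cw_I)

lemma tendsto_cw_D_quotient:
  assumes "\<bar>m\<bar> < 1"
  shows "((\<lambda>x. cw_D m x / (x - m)\<^sup>2) \<longlongrightarrow> 1 / (1 - m\<^sup>2) / 2) (at m)"
proof (rule tendsto_quotient_square[where f' = "\<lambda>x. artanh x - artanh m"])
  show "\<forall>\<^sub>F x in nhds m. (cw_D m has_real_derivative artanh x - artanh m) (at x)"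
    using eventually_abs_less_1[OF assms] unfolding cw_D_def[abs_def]
    by eventually_elim (auto intro!: derivative_eq_intros has_real_derivative_cw_I)
qed (use assms in \<open>auto intro!: derivative_eq_intros\<close>)

lemma tendsto_power_remainder_quotient:
  "((\<lambda>x. power_remainder p m x / (x - m)\<^sup>2) \<longlongrightarrow> real p * (real (p - 1) * m ^ (p - 2)) / 2) (at m)"
proof (rule tendsto_quotient_square[where f' = "\<lambda>x. real p * x ^ (p - 1) - real p * m ^ (p - 1)"])
  show "\<forall>\<^sub>F x in nhds m. (power_remainder p m has_real_derivative real p * x ^ (p - 1) - real p * m ^ (p - 1)) (at x)"
    unfolding power_remainder_def[abs_def]
    by (auto intro!: derivative_eq_intros always_eventually)
qed (auto simp: power_remainder_def numeral_2_eq_2 intro!: derivative_eq_intros)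

section \<open>Large deviations of independent spins\<close>

lemma finite_cw_conf [simp]: "finite (cw_conf N)"
  using finite_lists_length_eq[of "{-1, 1 :: int}" N]
  by (simp add: cw_conf_def conj_commute)

lemma cw_mag_scaled: "xs \<in> cw_conf N \<Longrightarrow> real N * cw_mag xs = real_of_int (sum_list xs)"
  by (auto simp: cw_conf_def cw_mag_def)

lemma abs_sum_list_le: "set xs \<subseteq> {-1, 1} \<Longrightarrow> \<bar>sum_list xs :: int\<bar> \<le> int (length xs)"
  by (induction xs) auto

lemma cw_mag_bounds: "xs \<in> cw_conf N \<Longrightarrow> cw_mag xs \<in> {-1..1}"
proof -
  assume "xs \<in> cw_conf N"
  then have "\<bar>real_of_int (sum_list xs)\<bar> \<le> real (length xs)"
    using abs_sum_list_le[of xs] unfolding cw_conf_def by (simp flip: of_int_abs)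
  then show ?thesis
    by (cases "length xs = 0") (auto simp: cw_mag_def field_simps abs_le_iff)
qed

definition spin_pmf :: "real \<Rightarrow> int pmf" where
  "spin_pmf m = map_pmf (\<lambda>b. if b then 1 else -1) (bernoulli_pmf ((1 + m) / 2))"

lemma pmf_spin_pmf:
  assumes "\<bar>m\<bar> < 1"
  shows "pmf (spin_pmf m) 1 = (1 + m) / 2" and "pmf (spin_pmf m) (-1) = (1 - m) / 2"
proof -
  have inj: "inj (\<lambda>b. if b then 1 else -1 :: int)"
    by (auto simp: inj_def split: if_splits)
  show "pmf (spin_pmf m) 1 = (1 + m) / 2"
    using pmf_map_inj'[OF inj, of "bernoulli_pmf ((1 + m) / 2)" True] assms
    by (auto simp: spin_pmf_def abs_less_iff)
  show "pmf (spin_pmf m) (-1) = (1 - m) / 2"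
    using pmf_map_inj'[OF inj, of "bernoulli_pmf ((1 + m) / 2)" False] assms
    by (auto simp: spin_pmf_def abs_less_iff field_simps)
qed

lemma set_spin_pmf: "\<bar>m\<bar> < 1 \<Longrightarrow> set_pmf (spin_pmf m) = {-1, 1}"
  by (auto simp: spin_pmf_def abs_less_iff)

text \<open>The exponential family form with natural parameter \<open>artanh m\<close>. The
  log-probability of a configuration becomes affine in its sum, so changing \<open>m\<close> acts
  like changing the field.\<close>

lemma pmf_spin_pmf_exp:
  assumes "\<bar>m\<bar> < 1" and "x \<in> {-1, 1}"
  shows "pmf (spin_pmf m) x = exp (ln (1 - m\<^sup>2) / 2 - ln 2 + artanh m * real_of_int x)"
proof -
  have "1 - m\<^sup>2 = (1 + m) * (1 - m)"
    by (simp add: algebra_simps power2_eq_square)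
  then have "ln (1 - m\<^sup>2) = ln (1 + m) + ln (1 - m)"
    using assms(1) by (simp add: ln_mult abs_less_iff)
  then have "exp (ln (1 - m\<^sup>2) / 2 - ln 2 + artanh m * real_of_int x)
      = (if x = 1 then exp (ln (1 + m) - ln 2) else exp (ln (1 - m) - ln 2))"
    using assms by (auto simp: artanh_ln field_simps intro!: arg_cong[of _ _ exp])
  also have "\<dots> = (if x = 1 then (1 + m) / 2 else (1 - m) / 2)"
    using assms(1) by (simp add: exp_diff abs_less_iff)
  finally show ?thesis
    using pmf_spin_pmf[OF assms(1)] assms(2) by auto
qed

lemma replicate_pmf_Suc_pair:
  "replicate_pmf (Suc n) p = map_pmf (\<lambda>(x, xs). x # xs) (pair_pmf p (replicate_pmf n p))"
  by (simp add: map_pmf_def pair_pmf_def bind_assoc_pmf bind_return_pmf)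

lemma pmf_replicate_pmf_Suc:
  "pmf (replicate_pmf (Suc n) p) (x # xs) = pmf p x * pmf (replicate_pmf n p) xs"
proof -
  have "inj (\<lambda>(x, xs). x # xs :: 'a list)"
    by (auto simp: inj_def)
  from pmf_map_inj'[OF this, of "pair_pmf p (replicate_pmf n p)" "(x, xs)"] show ?thesis
    by (simp only: replicate_pmf_Suc_pair pmf_pair case_prod_conv)
qed

lemma set_replicate_spin_pmf: "\<bar>m\<bar> < 1 \<Longrightarrow> set_pmf (replicate_pmf N (spin_pmf m)) = cw_conf N"
  by (auto simp: set_replicate_pmf set_spin_pmf cw_conf_def lists_eq_set)

lemma pmf_replicate_spin_pmf:
  assumes "\<bar>m\<bar> < 1" and "xs \<in> cw_conf N"
  shows "pmf (replicate_pmf N (spin_pmf m)) xs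
    = exp (real N * (ln (1 - m\<^sup>2) / 2 - ln 2) + artanh m * real_of_int (sum_list xs))"
  using assms(2)
proof (induction N arbitrary: xs)
  case 0
  then show ?case by (simp add: cw_conf_def)
next
  case (Suc N)
  then obtain x ys where xs: "xs = x # ys" and x: "x \<in> {-1, 1}" and ys: "ys \<in> cw_conf N"
    by (cases xs) (auto simp: cw_conf_def)
  show ?case
    unfolding xs pmf_replicate_pmf_Suc Suc.IH[OF ys] pmf_spin_pmf_exp[OF assms(1) x]
    by (simp flip: exp_add add: algebra_simps)
qed

lemma expectation_replicate_spin_pmf:
  "\<bar>m\<bar> < 1 \<Longrightarrow> measure_pmf.expectation (replicate_pmf N (spin_pmf m)) (F :: _ \<Rightarrow> real)
    = (\<Sum>xs\<in>cw_conf N. pmf (replicate_pmf N (spin_pmf m)) xs * F xs)"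
  by (subst integral_measure_pmf[of "cw_conf N"]) (auto simp: set_replicate_spin_pmf mult.commute)

text \<open>Change of measure from mean \<open>m\<close> to mean \<open>y\<close>: the logarithm of
  the likelihood ratio is
  \<open>- N * cw_D m y - N * (artanh y - artanh m) * (cw_mag xs - y)\<close>. As
  \<open>artanh\<close> increases, \<open>sep\<close> makes the second product nonnegative on
  \<open>S\<close>, that is, on configurations lying beyond \<open>y\<close> as seen from
  \<open>m\<close>.\<close>

lemma chernoff_bound_interior:
  assumes m: "\<bar>m\<bar> < 1" and y: "\<bar>y\<bar> < 1" and S: "S \<subseteq> cw_conf N"
    and sep: "\<And>xs. xs \<in> S \<Longrightarrow> 0 \<le> (y - m) * (cw_mag xs - y)"
  shows "measure_pmf.prob (replicate_pmf N (spin_pmf m)) S \<le> exp (- real N * cw_D m y)"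
proof -
  have fin: "finite S"
    using S by (rule finite_subset) simp
  have "pmf (replicate_pmf N (spin_pmf m)) xs
      \<le> exp (- real N * cw_D m y) * pmf (replicate_pmf N (spin_pmf y)) xs" if "xs \<in> S" for xs
  proof -
    have xs: "xs \<in> cw_conf N" using S that by blast
    have "0 \<le> (artanh y - artanh m) * (cw_mag xs - y)"
      using sep[OF that] artanh_strict_mono[of m y] artanh_strict_mono[of y m] m y
      by (cases y m rule: linorder_cases) (auto simp: zero_le_mult_iff abs_less_iff)
    then have "0 \<le> real N * ((artanh y - artanh m) * (cw_mag xs - y))"
      by simp
    also have "\<dots> = (artanh y - artanh m) * (real_of_int (sum_list xs) - real N * y)"
      by (simp add: algebra_simps flip: cw_mag_scaled[OF xs])
    finally have "real N * (ln (1 - m\<^sup>2) / 2 - ln 2) + artanh m * real_of_int (sum_list xs)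
      \<le> - real N * cw_D m y + (real N * (ln (1 - y\<^sup>2) / 2 - ln 2) + artanh y * real_of_int (sum_list xs))"
      unfolding cw_D_def cw_I_artanh[OF m] cw_I_artanh[OF y] by (simp add: algebra_simps)
    then show ?thesis
      unfolding pmf_replicate_spin_pmf[OF m xs] pmf_replicate_spin_pmf[OF y xs]
      by (simp flip: exp_add)
  qed
  then have "measure_pmf.prob (replicate_pmf N (spin_pmf m)) S
      \<le> (\<Sum>xs\<in>S. exp (- real N * cw_D m y) * pmf (replicate_pmf N (spin_pmf y)) xs)"
    unfolding measure_measure_pmf_finite[OF fin] by (rule sum_mono)
  also have "\<dots> = exp (- real N * cw_D m y) * measure_pmf.prob (replicate_pmf N (spin_pmf y)) S"
    unfolding measure_measure_pmf_finite[OF fin] by (simp add: sum_distrib_left)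
  also have "\<dots> \<le> exp (- real N * cw_D m y) * 1"
    by (intro mult_left_mono) auto
  finally show ?thesis by simp
qed

lemma chernoff_bound:
  assumes m: "\<bar>m\<bar> < 1" and y: "y \<in> {-1..1}" and S: "S \<subseteq> cw_conf N"
    and sep: "\<And>xs. xs \<in> S \<Longrightarrow> 0 \<le> (y - m) * (cw_mag xs - y)"
  shows "measure_pmf.prob (replicate_pmf N (spin_pmf m)) S \<le> exp (- real N * cw_D m y)"
proof -
  define z where "z t = m + t * (y - m)" for t
  have z: "\<bar>z t\<bar> < 1" if "0 \<le> t" "t < 1" for t
  proof -
    have "\<bar>z t\<bar> = \<bar>(1 - t) * m + t * y\<bar>" by (simp add: z_def algebra_simps)
    also have "\<dots> \<le> (1 - t) * \<bar>m\<bar> + t * \<bar>y\<bar>"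
      using that abs_triangle_ineq[of "(1 - t) * m" "t * y"] by (simp add: abs_mult)
    also have "\<dots> < (1 - t) * 1 + t * 1"
      using that m y by (intro add_less_le_mono mult_strict_left_mono mult_left_mono) auto
    finally show ?thesis by simp
  qed
  have bound: "measure_pmf.prob (replicate_pmf N (spin_pmf m)) S \<le> exp (- real N * cw_D m (z t))"
    if t: "0 < t" "t < 1" for t
  proof (rule chernoff_bound_interior[OF m z S])
    fix xs assume "xs \<in> S"
    from sep[OF this] have "0 \<le> t * ((y - m) * (cw_mag xs - y)) + t * (1 - t) * (y - m)\<^sup>2"
      using t by (intro add_nonneg_nonneg mult_nonneg_nonneg[of t] mult_nonneg_nonneg[of "t * (1 - t)"]) auto
    also have "\<dots> = (z t - m) * (cw_mag xs - z t)"
      by (simp add: z_def algebra_simps power2_eq_square)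
    finally show "0 \<le> (z t - m) * (cw_mag xs - z t)" .
  qed (use t in auto)
  have zI: "z t \<in> {-1..1}" if "t \<in> {0..1}" for t
    using that z[of t] y by (cases "t = 1") (auto simp: z_def)
  have "continuous_on {0..1} z"
    unfolding z_def by (intro continuous_intros)
  then have "continuous_on {0..1} (\<lambda>t. exp (- real N * cw_D m (z t)))"
    using zI by (intro continuous_intros continuous_on_compose2[OF continuous_on_cw_D]) auto
  then have "((\<lambda>t. exp (- real N * cw_D m (z t))) \<longlongrightarrow> exp (- real N * cw_D m (z 1))) (at 1 within {0..1})"
    unfolding continuous_on_def by simp
  then have "((\<lambda>t. exp (- real N * cw_D m (z t))) \<longlongrightarrow> exp (- real N * cw_D m y)) (at_left 1)"
    by (simp add: z_def at_within_Icc_at_left)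
  moreover have "\<forall>\<^sub>F t in at_left 1. measure_pmf.prob (replicate_pmf N (spin_pmf m)) S
      \<le> exp (- real N * cw_D m (z t))"
    by (rule eventually_mono[OF eventually_at_left_real[of 0 1]]) (use bound in auto)
  ultimately show ?thesis
    by (rule tendsto_lowerbound) simp
qed

text \<open>On each side of \<open>m\<close>, the event lies beyond its own configuration nearest to
  \<open>m\<close>, and that configuration already satisfies the inequality with \<open>v\<close>.
  The one-sided bound at this point suffices, without monotonicity of \<open>cw_D\<close>; the
  factor 2 counts the two sides.\<close>

lemma prob_cw_D_ge:
  assumes m: "\<bar>m\<bar> < 1"
  shows "measure_pmf.prob (replicate_pmf N (spin_pmf m)) {xs. v \<le> real N * cw_D m (cw_mag xs)} \<le> 2 * exp (- v)"
proof (cases "v \<le> 0")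
  case True
  then have "1 \<le> exp (- v)" by simp
  then show ?thesis
    using measure_pmf.prob_le_1[of "replicate_pmf N (spin_pmf m)" "{xs. v \<le> real N * cw_D m (cw_mag xs)}"]
    by linarith
next
  case False
  let ?P = "measure_pmf.prob (replicate_pmf N (spin_pmf m))"
  define A where "A = {xs \<in> cw_conf N. v \<le> real N * cw_D m (cw_mag xs)}"
  have A: "finite A" "A \<subseteq> cw_conf N" by (auto simp: A_def)
  have bound: "?P B \<le> exp (- v)"
    if "ys \<in> B" "B \<subseteq> A" "\<And>xs. xs \<in> B \<Longrightarrow> 0 \<le> (cw_mag ys - m) * (cw_mag xs - cw_mag ys)" for B ys
  proof -
    have ys: "ys \<in> A" using that by blast
    then have "?P B \<le> exp (- real N * cw_D m (cw_mag ys))"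
      using that A cw_mag_bounds[of ys N] by (intro chernoff_bound[OF m]) auto
    also have "\<dots> \<le> exp (- v)" using ys by (simp add: A_def)
    finally show ?thesis .
  qed
  have right: "?P {xs \<in> A. m < cw_mag xs} \<le> exp (- v)"
  proof (cases "{xs \<in> A. m < cw_mag xs} = {}")
    case False
    then obtain ys where ys: "ys \<in> {xs \<in> A. m < cw_mag xs}"
      "cw_mag ys = Min (cw_mag ` {xs \<in> A. m < cw_mag xs})"
      using Min_in[of "cw_mag ` {xs \<in> A. m < cw_mag xs}"] A(1) by fastforce
    show ?thesis
      by (rule bound[OF ys(1)]) (use A(1) ys(1) in \<open>auto simp: ys(2) intro!: mult_nonneg_nonneg\<close>)
  next
    case True
    show ?thesis unfolding True by simp
  qed
  have left: "?P {xs \<in> A. cw_mag xs < m} \<le> exp (- v)"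
  proof (cases "{xs \<in> A. cw_mag xs < m} = {}")
    case False
    then obtain ys where ys: "ys \<in> {xs \<in> A. cw_mag xs < m}"
      "cw_mag ys = Max (cw_mag ` {xs \<in> A. cw_mag xs < m})"
      using Max_in[of "cw_mag ` {xs \<in> A. cw_mag xs < m}"] A(1) by fastforce
    show ?thesis
      by (rule bound[OF ys(1)]) (use A(1) ys(1) in \<open>auto simp: ys(2) intro!: mult_nonpos_nonpos\<close>)
  next
    case True
    show ?thesis unfolding True by simp
  qed
  \<comment> \<open>Since \<open>v\<close> is positive and \<open>cw_D m m = 0\<close>, no
    configuration of mean exactly \<open>m\<close> lies in \<open>A\<close>.\<close>
  have "cw_mag xs \<noteq> m" if "xs \<in> A" for xs
    using that False by (auto simp: A_def)
  then have "A = {xs \<in> A. m < cw_mag xs} \<union> {xs \<in> A. cw_mag xs < m}"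
    by (auto simp: neq_iff)
  then have "?P A = ?P ({xs \<in> A. m < cw_mag xs} \<union> {xs \<in> A. cw_mag xs < m})"
    by (rule arg_cong)
  also have "\<dots> \<le> ?P {xs \<in> A. m < cw_mag xs} + ?P {xs \<in> A. cw_mag xs < m}"
    by (rule measure_Un_le) auto
  finally have "?P A \<le> exp (- v) + exp (- v)"
    using left right by linarith
  also have "?P A = ?P {xs. v \<le> real N * cw_D m (cw_mag xs)}"
    by (rule measure_prob_cong_0) (auto simp: A_def set_replicate_spin_pmf[OF m] pmf_eq_0_set_pmf)
  finally show ?thesis by simp
qed

text \<open>Cutting the range of \<open>V\<close> into unit layers bounds
  \<open>exp (l * V x)\<close> by 1 plus a sum of layer indicators with weights
  \<open>exp (l * (j + 1))\<close>. The tails turn this into a geometric series of ratio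
  \<open>exp (l - 1)\<close>, convergent as \<open>l < 1\<close>. The bound does not involve
  \<open>M\<close>, hence will be uniform in \<open>N\<close>.\<close>

lemma exp_moment_of_exp_tail:
  fixes V :: "'a \<Rightarrow> real" and M :: "'a pmf"
  assumes fin: "finite (set_pmf M)" and l: "l < 1"
    and tail: "\<And>j::nat. measure_pmf.prob M {x. real j \<le> V x} \<le> 2 * exp (- real j)"
    and "0 \<le> l"
  shows "measure_pmf.expectation M (\<lambda>x. exp (l * V x)) \<le> 1 + 2 * exp l / (1 - exp (l - 1))"
proof -
  \<comment> \<open>A finite support bounds \<open>V\<close>, so finitely many layers suffice and no
    series has to be integrated.\<close>
  obtain J :: nat where J: "\<And>x. x \<in> set_pmf M \<Longrightarrow> V x < real J"
  proof -
    obtain b where "\<And>x. x \<in> set_pmf M \<Longrightarrow> V x \<le> b"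
      using finite_imageI[OF fin, of V] by (meson bdd_above_finite bdd_above.unfold image_eqI)
    moreover obtain J :: nat where "b < real J" using reals_Archimedean2 by blast
    ultimately show thesis by (intro that[of J]) force
  qed
  note [simp] = integrable_measure_pmf_finite[OF fin]
  have "measure_pmf.expectation M (\<lambda>x. exp (l * V x))
     \<le> measure_pmf.expectation M (\<lambda>x. 1 + (\<Sum>j<J. exp (l * (real j + 1)) * indicator {x. real j \<le> V x} x))"
  proof (rule integral_mono_AE)
    show "AE x in measure_pmf M. exp (l * V x)
      \<le> 1 + (\<Sum>j<J. exp (l * (real j + 1)) * indicator {x. real j \<le> V x} x)"
    proof (rule AE_pmfI)
      fix x assume x: "x \<in> set_pmf M"
      show "exp (l * V x) \<le> 1 + (\<Sum>j<J. exp (l * (real j + 1)) * indicator {x. real j \<le> V x} x)"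
      proof (cases "0 \<le> V x")
        case True
        define k where "k = nat \<lfloor>V x\<rfloor>"
        have k: "real k \<le> V x" "V x < real k + 1"
          using True by (auto simp: k_def)
        have "k < J" using k(1) J[OF x] by linarith
        have "exp (l * V x) \<le> exp (l * (real k + 1)) * indicator {x. real k \<le> V x} x"
          using k \<open>0 \<le> l\<close> by (auto intro!: mult_left_mono)
        also have "\<dots> \<le> (\<Sum>j<J. exp (l * (real j + 1)) * indicator {x. real j \<le> V x} x)"
          using \<open>k < J\<close> by (intro member_le_sum) auto
        finally show ?thesis by simp
      next
        case False
        then have "exp (l * V x) \<le> 1"
          using \<open>0 \<le> l\<close> by (auto simp: mult_nonneg_nonpos)
        also have "\<dots> \<le> 1 + (\<Sum>j<J. exp (l * (real j + 1)) * indicator {x. real j \<le> V x} x)"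
          by (simp add: sum_nonneg)
        finally show ?thesis .
      qed
    qed
  qed auto
  also have "\<dots> = 1 + (\<Sum>j<J. exp (l * (real j + 1)) * measure_pmf.prob M {x. real j \<le> V x})"
    by (subst Bochner_Integration.integral_add, simp, simp, subst Bochner_Integration.integral_sum) simp_all
  also have "\<dots> \<le> 1 + (\<Sum>j<J. exp (l * (real j + 1)) * (2 * exp (- real j)))"
    by (intro add_left_mono sum_mono mult_left_mono tail) auto
  also have "\<dots> = 1 + 2 * exp l * (\<Sum>j<J. exp (l - 1) ^ j)"
  proof -
    have "exp (l * (real j + 1)) * exp (- real j) = exp l * exp (l - 1) ^ j" for j
      by (simp add: algebra_simps flip: exp_add exp_of_nat_mult)
    then show ?thesis
      by (simp add: sum_distrib_left mult.left_commute mult.assoc)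
  qed
  also have "(\<Sum>j<J. exp (l - 1) ^ j) \<le> 1 / (1 - exp (l - 1))"
    using l by (subst suminf_geometric[symmetric]) (auto intro!: sum_le_suminf summable_geometric)
  finally show ?thesis by simp
qed

lemma exp_moment_cw_D:
  assumes "\<bar>m\<bar> < 1" and "0 \<le> l" and "l < 1"
  shows "measure_pmf.expectation (replicate_pmf N (spin_pmf m)) (\<lambda>xs. exp (l * (real N * cw_D m (cw_mag xs))))
    \<le> 1 + 2 * exp l / (1 - exp (l - 1))"
  using assms by (intro exp_moment_of_exp_tail prob_cw_D_ge) (auto simp: set_replicate_spin_pmf)

section \<open>Central limit theorem for independent spins\<close>

lemma char_distr_replicate_pmf:
  fixes g :: "'a \<Rightarrow> real"
  assumes fin: "finite (set_pmf p)"
  shows "char (distr (measure_pmf (replicate_pmf n p)) borel (\<lambda>xs. \<Sum>x\<leftarrow>xs. g x)) t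
    = char (distr (measure_pmf p) borel g) t ^ n"
proof (induction n)
  case 0
  then show ?case by (simp add: char_def integral_distr)
next
  case (Suc n)
  have finq: "finite (set_pmf (replicate_pmf n p))"
    using finite_lists_length_eq[OF fin, of n] by (simp add: set_replicate_pmf lists_eq_set)
  have char_pmf: "char (distr (measure_pmf q) borel f) t = measure_pmf.expectation q (\<lambda>x. iexp (t * f x))"
    for q :: "'b pmf" and f
    by (simp add: char_def integral_distr)
  have "char (distr (measure_pmf (replicate_pmf (Suc n) p)) borel (\<lambda>xs. \<Sum>x\<leftarrow>xs. g x)) t
     = measure_pmf.expectation (pair_pmf p (replicate_pmf n p)) (\<lambda>(x, xs). iexp (t * g x) * iexp (t * (\<Sum>x\<leftarrow>xs. g x)))"
    unfolding char_pmf replicate_pmf_Suc_pair integral_map_pmf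
    by (simp add: case_prod_unfold algebra_simps flip: exp_add)
  also have "\<dots> = (\<Sum>z\<in>set_pmf p \<times> set_pmf (replicate_pmf n p). pmf (pair_pmf p (replicate_pmf n p)) z *\<^sub>R
      (case z of (x, xs) \<Rightarrow> iexp (t * g x) * iexp (t * (\<Sum>x\<leftarrow>xs. g x))))"
    using fin finq by (intro integral_measure_pmf) auto
  also have "\<dots> = (\<Sum>x\<in>set_pmf p. pmf p x *\<^sub>R iexp (t * g x)) *
      (\<Sum>xs\<in>set_pmf (replicate_pmf n p). pmf (replicate_pmf n p) xs *\<^sub>R iexp (t * (\<Sum>x\<leftarrow>xs. g x)))"
    unfolding sum_product sum.cartesian_product
    by (intro sum.cong) (auto simp: pmf_pair scaleR_conv_of_real)
  also have "(\<Sum>x\<in>set_pmf p. pmf p x *\<^sub>R iexp (t * g x)) = char (distr (measure_pmf p) borel g) t"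
    unfolding char_pmf using fin by (intro integral_measure_pmf[symmetric]) auto
  also have "(\<Sum>xs\<in>set_pmf (replicate_pmf n p). pmf (replicate_pmf n p) xs *\<^sub>R iexp (t * (\<Sum>x\<leftarrow>xs. g x)))
     = char (distr (measure_pmf (replicate_pmf n p)) borel (\<lambda>xs. \<Sum>x\<leftarrow>xs. g x)) t"
    unfolding char_pmf using finq by (intro integral_measure_pmf[symmetric]) auto
  finally show ?case by (simp add: Suc.IH)
qed

lemma real_distribution_distr_pmf: "real_distribution (distr (measure_pmf p) borel (f :: _ \<Rightarrow> real))"
  by (intro prob_space.real_distribution_distr measure_pmf.prob_space_axioms) simp

text \<open>The laws \<open>replicate_pmf n p\<close> live on lists whose length varies with
  \<open>n\<close>, while the classical theorem concerns one infinite independent sequence. That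
  sequence is built as the coordinates of an infinite product of copies of the law of
  \<open>f\<close>; equality of the characteristic functions carries the limit over through Levy's
  theorem.\<close>

theorem central_limit_theorem_replicate_pmf:
  fixes f :: "'a \<Rightarrow> real" and \<sigma> :: real
  assumes fin: "finite (set_pmf p)"
    and mean: "measure_pmf.expectation p f = 0"
    and var: "measure_pmf.expectation p (\<lambda>x. (f x)\<^sup>2) = \<sigma>\<^sup>2" and "\<sigma> > 0"
  shows "weak_conv_m (\<lambda>n. distr (measure_pmf (replicate_pmf n p)) borel
      (\<lambda>xs. \<Sum>x\<leftarrow>xs. f x / sqrt (n * \<sigma>\<^sup>2))) std_normal_distribution"
proof -
  define \<mu> where "\<mu> = distr (measure_pmf p) borel f"
  interpret \<mu>: real_distribution \<mu>
    unfolding \<mu>_def by (rule real_distribution_distr_pmf)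
  interpret P: product_prob_space "\<lambda>_::nat. \<mu>" UNIV
    by standard
  let ?P = "PiM (UNIV :: nat set) (\<lambda>_. \<mu>)"
  have X_distr: "distr ?P borel (\<lambda>\<omega>. \<omega> i) = \<mu>" for i
    using P.PiM_component[of i] by (simp cong: distr_cong)
  have [measurable]: "(\<lambda>\<omega>. \<omega> i) \<in> borel_measurable ?P" for i
    using measurable_component_singleton[of i UNIV "\<lambda>_. \<mu>"] by simp
  have indep: "P.indep_vars (\<lambda>_. borel) (\<lambda>i \<omega>. \<omega> i) UNIV"
  proof (subst P.indep_vars_iff_distr_eq_PiM')
    have "sets (Pi\<^sub>M UNIV (\<lambda>_::nat. borel :: real measure)) = sets ?P"
      by (intro sets_PiM_cong) auto
    then have "distr ?P (Pi\<^sub>M UNIV (\<lambda>_. borel)) (\<lambda>\<omega>. \<lambda>i\<in>UNIV. \<omega> i) = distr ?P ?P (\<lambda>\<omega>. \<omega>)"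
      by (intro distr_cong) auto
    then show "distr ?P (Pi\<^sub>M UNIV (\<lambda>_. borel)) (\<lambda>\<omega>. \<lambda>i\<in>UNIV. \<omega> i)
      = Pi\<^sub>M UNIV (\<lambda>i. distr ?P borel (\<lambda>\<omega>. \<omega> i))"
      by (simp add: X_distr)
  qed auto
  have moments: "P.expectation (\<lambda>\<omega>. F (\<omega> i)) = measure_pmf.expectation p (\<lambda>x. F (f x))"
    "integrable ?P (\<lambda>\<omega>. F (\<omega> i))" if [measurable]: "F \<in> borel_measurable borel" for F :: "real \<Rightarrow> real" and i
  proof -
    have "P.expectation (\<lambda>\<omega>. F (\<omega> i)) = integral\<^sup>L (distr ?P borel (\<lambda>\<omega>. \<omega> i)) F"
      by (subst integral_distr) auto
    also have "\<dots> = measure_pmf.expectation p (\<lambda>x. F (f x))"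
      unfolding X_distr unfolding \<mu>_def by (subst integral_distr) auto
    finally show "P.expectation (\<lambda>\<omega>. F (\<omega> i)) = measure_pmf.expectation p (\<lambda>x. F (f x))" .
    have "integrable (distr (measure_pmf p) borel f) F"
      by (subst integrable_distr_eq) (auto intro: integrable_measure_pmf_finite[OF fin])
    then have "integrable (distr ?P borel (\<lambda>\<omega>. \<omega> i)) F"
      unfolding X_distr by (simp add: \<mu>_def)
    then show "integrable ?P (\<lambda>\<omega>. F (\<omega> i))"
      by (subst (asm) integrable_distr_eq) auto
  qed
  have clt: "weak_conv_m (\<lambda>n. distr ?P borel (\<lambda>\<omega>. (\<Sum>i<n. \<omega> i) / sqrt (n * \<sigma>\<^sup>2))) std_normal_distribution"
  proof (rule P.central_limit_theorem_zero_mean[where X = "\<lambda>i \<omega>. \<omega> i" and \<mu> = \<mu>, OF indep])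
    show mean': "P.expectation (\<lambda>\<omega>. \<omega> i) = 0" for i
      using moments(1)[of "\<lambda>x. x" i] mean by simp
    show "integrable ?P (\<lambda>\<omega>. (\<omega> i)\<^sup>2)" for i
      using moments(2)[of "\<lambda>x. x\<^sup>2" i] by simp
    show "P.variance (\<lambda>\<omega>. \<omega> i) = \<sigma>\<^sup>2" for i
      using moments(1)[of "\<lambda>x. x\<^sup>2" i] var mean'[of i] by simp
  qed (use \<open>\<sigma> > 0\<close> X_distr in auto)
  show ?thesis
  proof (rule levy_continuity)
    fix t
    have "char (distr ?P borel (\<lambda>\<omega>. (\<Sum>i<n. \<omega> i) / sqrt (n * \<sigma>\<^sup>2))) t
      = char (distr (measure_pmf (replicate_pmf n p)) borel (\<lambda>xs. \<Sum>x\<leftarrow>xs. f x / sqrt (n * \<sigma>\<^sup>2))) t" for n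
    proof -
      have "char (distr ?P borel (\<lambda>\<omega>. (\<Sum>i<n. \<omega> i) / sqrt (n * \<sigma>\<^sup>2))) t
        = char (distr ?P borel (\<lambda>\<omega>. \<Sum>i<n. \<omega> i / sqrt (n * \<sigma>\<^sup>2))) t"
        by (simp add: sum_divide_distrib)
      also have "\<dots> = (\<Prod>i<n. char (distr ?P borel (\<lambda>\<omega>. \<omega> i / sqrt (n * \<sigma>\<^sup>2))) t)"
        by (rule P.char_distr_sum, rule P.indep_vars_compose2[OF P.indep_vars_subset[OF indep]]) auto
      also have "\<dots> = (\<Prod>i<n. char (distr (measure_pmf p) borel (\<lambda>x. f x / sqrt (n * \<sigma>\<^sup>2))) t)"
      proof (rule prod.cong[OF refl])
        fix i
        have "distr ?P borel (\<lambda>\<omega>. \<omega> i / sqrt (n * \<sigma>\<^sup>2)) = distr (distr ?P borel (\<lambda>\<omega>. \<omega> i)) borel (\<lambda>x. x / sqrt (n * \<sigma>\<^sup>2))"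
          by (subst distr_distr) (auto simp: comp_def)
        also have "\<dots> = distr (measure_pmf p) borel (\<lambda>x. f x / sqrt (n * \<sigma>\<^sup>2))"
          unfolding X_distr unfolding \<mu>_def by (subst distr_distr) (auto simp: comp_def)
        finally show "char (distr ?P borel (\<lambda>\<omega>. \<omega> i / sqrt (n * \<sigma>\<^sup>2))) t
          = char (distr (measure_pmf p) borel (\<lambda>x. f x / sqrt (n * \<sigma>\<^sup>2))) t" by simp
      qed
      finally show ?thesis
        by (simp add: char_distr_replicate_pmf[OF fin])
    qed
    moreover have "(\<lambda>n. char (distr ?P borel (\<lambda>\<omega>. (\<Sum>i<n. \<omega> i) / sqrt (n * \<sigma>\<^sup>2))) t) \<longlonglongrightarrow> char std_normal_distribution t"
      by (rule levy_continuity1[OF _ real_dist_normal_dist clt]) (auto intro!: P.real_distribution_distr)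
    ultimately show "(\<lambda>n. char (distr (measure_pmf (replicate_pmf n p)) borel
        (\<lambda>xs. \<Sum>x\<leftarrow>xs. f x / sqrt (n * \<sigma>\<^sup>2))) t) \<longlonglongrightarrow> char std_normal_distribution t"
      by simp
  qed (auto intro: real_distribution_distr_pmf real_dist_normal_dist)
qed

lemma sum_list_centered: "(\<Sum>x\<leftarrow>xs. (real_of_int x - m) / c) = (real_of_int (sum_list xs) - real (length xs) * m) / c"
  by (induction xs) (auto simp: field_simps diff_divide_distrib add_divide_distrib)

lemma weak_conv_cw_mag_replicate_spin_pmf:
  assumes m: "\<bar>m\<bar> < 1"
  shows "weak_conv_m (\<lambda>n. distr (measure_pmf (replicate_pmf n (spin_pmf m))) borel
      (\<lambda>xs. sqrt (real n) * (cw_mag xs - m) / sqrt (1 - m\<^sup>2))) std_normal_distribution"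
proof -
  have v: "0 < 1 - m\<^sup>2" using m by (simp add: abs_square_less_1)
  have E: "measure_pmf.expectation (spin_pmf m) F = F 1 * ((1 + m) / 2) + F (-1) * ((1 - m) / 2)" for F :: "int \<Rightarrow> real"
    by (subst integral_measure_pmf[of "{-1, 1}"]) (auto simp: set_spin_pmf[OF m] pmf_spin_pmf[OF m] algebra_simps)
  have "weak_conv_m (\<lambda>n. distr (measure_pmf (replicate_pmf n (spin_pmf m))) borel
      (\<lambda>xs. \<Sum>x\<leftarrow>xs. (real_of_int x - m) / sqrt (real n * (sqrt (1 - m\<^sup>2))\<^sup>2))) std_normal_distribution"
    using v by (intro central_limit_theorem_replicate_pmf)
      (auto simp: set_spin_pmf[OF m] E, (simp add: field_simps power2_eq_square)+)
  moreover have "distr (measure_pmf (replicate_pmf n (spin_pmf m))) borel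
      (\<lambda>xs. \<Sum>x\<leftarrow>xs. (real_of_int x - m) / sqrt (real n * (sqrt (1 - m\<^sup>2))\<^sup>2))
    = distr (measure_pmf (replicate_pmf n (spin_pmf m))) borel
      (\<lambda>xs. sqrt (real n) * (cw_mag xs - m) / sqrt (1 - m\<^sup>2))" for n
  proof (rule distr_cong_AE)
    show "AE xs in measure_pmf (replicate_pmf n (spin_pmf m)).
       (\<Sum>x\<leftarrow>xs. (real_of_int x - m) / sqrt (real n * (sqrt (1 - m\<^sup>2))\<^sup>2))
       = sqrt (real n) * (cw_mag xs - m) / sqrt (1 - m\<^sup>2)"
    proof (rule AE_pmfI)
      fix xs assume "xs \<in> set_pmf (replicate_pmf n (spin_pmf m))"
      then have xs: "xs \<in> cw_conf n" by (simp add: set_replicate_spin_pmf[OF m])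
      then have "length xs = n" by (simp add: cw_conf_def)
      then have "(\<Sum>x\<leftarrow>xs. (real_of_int x - m) / sqrt (real n * (sqrt (1 - m\<^sup>2))\<^sup>2))
         = (real n * cw_mag xs - real n * m) / (sqrt (real n) * sqrt (1 - m\<^sup>2))"
        using v by (simp add: sum_list_centered cw_mag_scaled[OF xs] real_sqrt_mult)
      also have "\<dots> = sqrt (real n) * (cw_mag xs - m) / sqrt (1 - m\<^sup>2)"
      \<comment> \<open>For \<open>n = 0\<close> both sides are 0, by the factor
        \<open>sqrt 0\<close> and by division by zero.\<close>
      proof (cases "n = 0")
        case False
        have "real n * cw_mag xs - real n * m = sqrt (real n) * (sqrt (real n) * (cw_mag xs - m))"
          by (simp add: algebra_simps)
        with False show ?thesis by simp
      qed simp
      finally show "(\<Sum>x\<leftarrow>xs. (real_of_int x - m) / sqrt (real n * (sqrt (1 - m\<^sup>2))\<^sup>2))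
         = sqrt (real n) * (cw_mag xs - m) / sqrt (1 - m\<^sup>2)" .
    qed
  qed auto
  ultimately show ?thesis by simp
qed

section \<open>Integrals along weakly convergent sequences\<close>

text \<open>Weak convergence does not cover integrands that vary with \<open>n\<close> and are
  unbounded. Skorohod's representation replaces the laws by pointwise convergent variables.
  Dominated convergence then handles the region \<open>\<bar>x\<bar> \<le> T\<close>, with
  \<open>E T\<close> bounding the rest uniformly in \<open>n\<close>. Absence of atoms in
  \<open>M\<close> keeps the limit variable off the cut points \<open>T\<close> and
  \<open>- T\<close>, almost surely.\<close>

lemma integral_tendsto_of_weak_conv:
  fixes \<mu> :: "nat \<Rightarrow> real measure" and M :: "real measure"
    and \<phi> :: "nat \<Rightarrow> real \<Rightarrow> real" and \<psi> :: "real \<Rightarrow> real" and E :: "real \<Rightarrow> real"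
  assumes \<mu>: "\<And>n. real_distribution (\<mu> n)" and M: "real_distribution M" and conv: "weak_conv_m \<mu> M"
    and [measurable]: "\<And>n. \<phi> n \<in> borel_measurable borel" "\<psi> \<in> borel_measurable borel"
    and atomless: "\<And>c. AE x in M. x \<noteq> c"
    and lim: "AE x in M. \<forall>X. X \<longlonglongrightarrow> x \<longrightarrow> (\<lambda>n. \<phi> n (X n)) \<longlonglongrightarrow> \<psi> x"
    and bdd: "\<And>T. \<exists>B. \<forall>n x. \<bar>x\<bar> \<le> T \<longrightarrow> \<bar>\<phi> n x\<bar> \<le> B"
    and int: "\<And>n. integrable (\<mu> n) (\<phi> n)" "integrable M \<psi>"
    and tail: "\<And>n T. T > 0 \<Longrightarrow> (\<integral>x. \<bar>\<phi> n x\<bar> * indicator {x. T < \<bar>x\<bar>} x \<partial>\<mu> n) \<le> E T"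
    and E: "(E \<longlongrightarrow> 0) at_top"
  shows "(\<lambda>n. \<integral>x. \<phi> n x \<partial>\<mu> n) \<longlonglongrightarrow> (\<integral>x. \<psi> x \<partial>M)"
proof -
  obtain \<Omega> :: "real measure" and Y :: "nat \<Rightarrow> real \<Rightarrow> real" and Z :: "real \<Rightarrow> real"
    where \<Omega>: "prob_space \<Omega>" and Y [measurable]: "\<And>n. Y n \<in> borel_measurable \<Omega>"
      and dY: "\<And>n. distr \<Omega> borel (Y n) = \<mu> n" and Z': "Z \<in> measurable \<Omega> lborel"
      and dZ: "distr \<Omega> borel Z = M" and YZ: "\<And>x. x \<in> space \<Omega> \<Longrightarrow> (\<lambda>n. Y n x) \<longlonglongrightarrow> Z x"
    using Skorohod[OF \<mu> M conv] by blast
  have Z [measurable]: "Z \<in> borel_measurable \<Omega>" using Z' by simp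
  interpret \<Omega>: prob_space \<Omega> by (rule \<Omega>)
  define tr :: "real \<Rightarrow> real \<Rightarrow> real" where "tr T x = indicator {- T..T} x" for T x
  have [measurable]: "tr T \<in> borel_measurable borel" for T
    unfolding tr_def by simp
  have tr_bound: "0 \<le> tr T x" "tr T x \<le> 1" for T x by (auto simp: tr_def indicator_def)
  have int_\<phi>: "integrable \<Omega> (\<lambda>w. \<phi> n (Y n w))" for n
    using int(1)[of n] by (simp add: dY[symmetric] integrable_distr_eq)
  have int_\<psi>: "integrable \<Omega> (\<lambda>w. \<psi> (Z w))"
    using int(2) by (simp add: dZ[symmetric] integrable_distr_eq)
  have AE_Z: "AE w in \<Omega>. P (Z w)" if "AE x in M. P x" for P
    using that unfolding dZ[symmetric] by (rule AE_distrD[OF Z])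
  have lim_T: "(\<lambda>n. \<integral>w. \<phi> n (Y n w) * tr T (Y n w) \<partial>\<Omega>) \<longlonglongrightarrow> (\<integral>w. \<psi> (Z w) * tr T (Z w) \<partial>\<Omega>)" for T
  proof -
    obtain B where B: "\<And>n x. \<bar>x\<bar> \<le> T \<Longrightarrow> \<bar>\<phi> n x\<bar> \<le> B" using bdd[of T] by blast
    show ?thesis
    proof (rule integral_dominated_convergence[where w = "\<lambda>_. \<bar>B\<bar>"])
      show "AE w in \<Omega>. (\<lambda>n. \<phi> n (Y n w) * tr T (Y n w)) \<longlonglongrightarrow> \<psi> (Z w) * tr T (Z w)"
        using AE_Z[OF lim] AE_Z[OF atomless[of T]] AE_Z[OF atomless[of "- T"]] AE_space
      proof eventually_elim
        case (elim w)
        have "isCont (tr T) (Z w)"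
        proof -
          have "Z w \<notin> frontier {- T..T}"
            using elim(2,3) by (auto simp: frontier_def interior_atLeastAtMost_real)
          then show ?thesis
            unfolding tr_def using isCont_indicator[of "Z w" "{- T..T}"] by simp
        qed
        then show ?case
          using elim(1,4) YZ[of w] by (intro tendsto_mult isCont_tendsto_compose[of "Z w" "tr T"]) auto
      qed
      show "AE w in \<Omega>. norm (\<phi> n (Y n w) * tr T (Y n w)) \<le> \<bar>B\<bar>" for n
      proof (rule AE_I2)
        fix w
        show "norm (\<phi> n (Y n w) * tr T (Y n w)) \<le> \<bar>B\<bar>"
        proof (cases "\<bar>Y n w\<bar> \<le> T")
          case True
          then have "tr T (Y n w) = 1" by (simp add: tr_def abs_le_iff minus_le_iff)
          then show ?thesis using B[OF True, of n] by simp
        next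
          case False
          then have "tr T (Y n w) = 0" by (auto simp: tr_def indicator_def)
          then show ?thesis by simp
        qed
      qed
    qed auto
  qed
  have tail': "\<bar>(\<integral>w. \<phi> n (Y n w) \<partial>\<Omega>) - (\<integral>w. \<phi> n (Y n w) * tr T (Y n w) \<partial>\<Omega>)\<bar> \<le> E T"
    if "T > 0" for n T
  proof -
    have int_tr: "integrable \<Omega> (\<lambda>w. \<phi> n (Y n w) * tr T (Y n w))"
      by (rule Bochner_Integration.integrable_bound[OF int_\<phi>[of n]]) (auto simp: abs_mult tr_def indicator_def)
    have "\<bar>(\<integral>w. \<phi> n (Y n w) \<partial>\<Omega>) - (\<integral>w. \<phi> n (Y n w) * tr T (Y n w) \<partial>\<Omega>)\<bar>
      = \<bar>\<integral>w. \<phi> n (Y n w) - \<phi> n (Y n w) * tr T (Y n w) \<partial>\<Omega>\<bar>"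
      using int_\<phi> int_tr by simp
    also have "\<dots> \<le> (\<integral>w. \<bar>\<phi> n (Y n w) - \<phi> n (Y n w) * tr T (Y n w)\<bar> \<partial>\<Omega>)"
      by (rule integral_abs_bound)
    also have "\<dots> = (\<integral>w. \<bar>\<phi> n (Y n w)\<bar> * indicator {x. T < \<bar>x\<bar>} (Y n w) \<partial>\<Omega>)"
      by (intro Bochner_Integration.integral_cong) (auto simp: tr_def indicator_def)
    also have "\<dots> = (\<integral>x. \<bar>\<phi> n x\<bar> * indicator {x. T < \<bar>x\<bar>} x \<partial>\<mu> n)"
      unfolding dY[symmetric] by (subst integral_distr) auto
    finally show ?thesis using tail[OF that, of n] by linarith
  qed
  have lim_\<psi>: "((\<lambda>T. \<integral>w. \<psi> (Z w) * tr (real T) (Z w) \<partial>\<Omega>) \<longlonglongrightarrow> (\<integral>w. \<psi> (Z w) \<partial>\<Omega>))"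
  proof (rule integral_dominated_convergence[where w = "\<lambda>w. \<bar>\<psi> (Z w)\<bar>"])
    show "AE w in \<Omega>. (\<lambda>T. \<psi> (Z w) * tr (real T) (Z w)) \<longlonglongrightarrow> \<psi> (Z w)"
    proof (rule AE_I2)
      fix w
      have "\<forall>\<^sub>F T in sequentially. \<psi> (Z w) = \<psi> (Z w) * tr (real T) (Z w)"
        using eventually_ge_at_top[of "nat \<lceil>\<bar>Z w\<bar>\<rceil>"]
        by eventually_elim (auto simp: tr_def indicator_def nat_le_iff ceiling_le_iff)
      then show "(\<lambda>T. \<psi> (Z w) * tr (real T) (Z w)) \<longlonglongrightarrow> \<psi> (Z w)"
        by (rule Lim_transform_eventually[OF tendsto_const])
    qed
    show "AE w in \<Omega>. norm (\<psi> (Z w) * tr (real T) (Z w)) \<le> \<bar>\<psi> (Z w)\<bar>" for T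
      by (auto simp: tr_def indicator_def)
  qed (use int_\<psi> in auto)
  have "(\<lambda>n. \<integral>w. \<phi> n (Y n w) \<partial>\<Omega>) \<longlonglongrightarrow> (\<integral>w. \<psi> (Z w) \<partial>\<Omega>)"
  \<comment> \<open>Three errors of size \<open>r / 3\<close>: truncating the integrand
    \<open>\<phi> n\<close>, truncating the limit integrand, and convergence of the truncated
    integrals. \<open>T\<close> is fixed before \<open>n\<close> grows.\<close>
  proof (rule LIMSEQ_I)
    fix r :: real assume r: "r > 0"
    have "(\<lambda>T. E (real T)) \<longlonglongrightarrow> 0"
      by (rule filterlim_compose[OF E filterlim_real_sequentially])
    then have "\<forall>\<^sub>F T in sequentially. \<bar>E (real T)\<bar> < r / 3"
      using tendstoD[of "\<lambda>T. E (real T)" 0 sequentially "r / 3"] r by (simp add: dist_real_def)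
    moreover have "\<forall>\<^sub>F T in sequentially. \<bar>(\<integral>w. \<psi> (Z w) * tr (real T) (Z w) \<partial>\<Omega>) - (\<integral>w. \<psi> (Z w) \<partial>\<Omega>)\<bar> < r / 3"
      using tendstoD[OF lim_\<psi>, of "r / 3"] r by (simp add: dist_real_def)
    moreover have "\<forall>\<^sub>F T in sequentially. (0::nat) < T"
      by (rule eventually_gt_at_top)
    ultimately have "\<forall>\<^sub>F T in sequentially. \<bar>E (real T)\<bar> < r / 3 \<and> 0 < T \<and>
        \<bar>(\<integral>w. \<psi> (Z w) * tr (real T) (Z w) \<partial>\<Omega>) - (\<integral>w. \<psi> (Z w) \<partial>\<Omega>)\<bar> < r / 3"
      by eventually_elim simp
    then obtain T :: nat where T: "\<bar>E (real T)\<bar> < r / 3" "0 < T"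
      "\<bar>(\<integral>w. \<psi> (Z w) * tr (real T) (Z w) \<partial>\<Omega>) - (\<integral>w. \<psi> (Z w) \<partial>\<Omega>)\<bar> < r / 3"
      using eventually_happens'[OF sequentially_bot] by blast
    have "\<forall>\<^sub>F n in sequentially. \<bar>(\<integral>w. \<phi> n (Y n w) * tr (real T) (Y n w) \<partial>\<Omega>)
        - (\<integral>w. \<psi> (Z w) * tr (real T) (Z w) \<partial>\<Omega>)\<bar> < r / 3"
      using tendstoD[OF lim_T[of "real T"], of "r / 3"] r by (simp add: dist_real_def)
    then have "\<forall>\<^sub>F n in sequentially. norm ((\<integral>w. \<phi> n (Y n w) \<partial>\<Omega>) - (\<integral>w. \<psi> (Z w) \<partial>\<Omega>)) < r"
    proof eventually_elim
      case (elim n)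
      have "\<bar>(\<integral>w. \<phi> n (Y n w) \<partial>\<Omega>) - (\<integral>w. \<phi> n (Y n w) * tr (real T) (Y n w) \<partial>\<Omega>)\<bar> \<le> E (real T)"
        using T(2) by (intro tail') simp
      with elim T(1,3) show ?case unfolding real_norm_def by linarith
    qed
    then show "\<exists>no. \<forall>n\<ge>no. norm ((\<integral>w. \<phi> n (Y n w) \<partial>\<Omega>) - (\<integral>w. \<psi> (Z w) \<partial>\<Omega>)) < r"
      by (simp add: eventually_sequentially)
  qed
  moreover have "(\<integral>w. \<phi> n (Y n w) \<partial>\<Omega>) = (\<integral>x. \<phi> n x \<partial>\<mu> n)" for n
    unfolding dY[symmetric] by (subst integral_distr) auto
  moreover have "(\<integral>w. \<psi> (Z w) \<partial>\<Omega>) = (\<integral>x. \<psi> x \<partial>M)"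
    unfolding dZ[symmetric] by (subst integral_distr) auto
  ultimately show ?thesis by simp
qed

section \<open>The tilted Gaussian limit\<close>

lemma std_normal_density_tilt:
  assumes v: "v > 0" and a: "a = 1 / v - b" "a > 0"
  shows "std_normal_density u * exp (b * (sqrt v * u)\<^sup>2 / 2 + s * (sqrt v * u))
    = sqrt v * (exp (s\<^sup>2 / (2 * a)) / sqrt (a * v)) * normal_density (s / a) (1 / sqrt a) (sqrt v * u)"
proof -
  \<comment> \<open>With \<open>t = sqrt v * u\<close> the left side is
    \<open>- a * t\<^sup>2 / 2 + s * t\<close>, because \<open>a = 1 / v - b\<close>; completing the
    square yields mean \<open>s / a\<close> and variance \<open>1 / a\<close>.\<close>
  have "- u\<^sup>2 / 2 + (b * (sqrt v * u)\<^sup>2 / 2 + s * (sqrt v * u))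
     = s\<^sup>2 / (2 * a) + (- (sqrt v * u - s / a)\<^sup>2 / (2 * (1 / sqrt a)\<^sup>2))"
  proof -
    have "b = 1 / v - a" using a by simp
    moreover define t where "t = sqrt v * u"
    moreover have "u = t / sqrt v" using v by (simp add: t_def)
    ultimately show ?thesis
      using v a(2) by (simp add: t_def[symmetric] power_divide power2_diff) (simp add: field_simps power2_eq_square)
  qed
  then have "exp (- u\<^sup>2 / 2) * exp (b * (sqrt v * u)\<^sup>2 / 2 + s * (sqrt v * u))
     = exp (s\<^sup>2 / (2 * a)) * exp (- (sqrt v * u - s / a)\<^sup>2 / (2 * (1 / sqrt a)\<^sup>2))"
    by (metis exp_add)
  moreover have "1 / sqrt (2 * pi) = sqrt v / sqrt (a * v) * (1 / sqrt (2 * pi * (1 / sqrt a)\<^sup>2))"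
    using v a(2) by (simp add: real_sqrt_mult real_sqrt_divide power_divide)
  ultimately show ?thesis
    unfolding std_normal_density_def normal_density_def
    by (simp only: mult.assoc) (simp add: field_simps)
qed

lemma std_normal_tilt_integral:
  fixes g :: "real \<Rightarrow> real"
  assumes v: "v > 0" and a: "a = 1 / v - b" "a > 0" and [measurable]: "g \<in> borel_measurable borel"
    and int: "integrable lborel (\<lambda>t. normal_density (s / a) (1 / sqrt a) t * g t)"
  shows "integrable std_normal_distribution (\<lambda>u. g (sqrt v * u) * exp (b * (sqrt v * u)\<^sup>2 / 2 + s * (sqrt v * u)))"
    and "(\<integral>u. g (sqrt v * u) * exp (b * (sqrt v * u)\<^sup>2 / 2 + s * (sqrt v * u)) \<partial>std_normal_distribution)
      = exp (s\<^sup>2 / (2 * a)) / sqrt (a * v) * (\<integral>t. normal_density (s / a) (1 / sqrt a) t * g t \<partial>lborel)"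
proof -
  let ?C = "exp (s\<^sup>2 / (2 * a)) / sqrt (a * v)"
  let ?f = "\<lambda>t. normal_density (s / a) (1 / sqrt a) t * g t"
  have eq: "std_normal_density u * (g (sqrt v * u) * exp (b * (sqrt v * u)\<^sup>2 / 2 + s * (sqrt v * u)))
    = sqrt v * ?C * ?f (sqrt v * u)" for u
    using arg_cong[OF std_normal_density_tilt[OF v a, of u s], of "\<lambda>z. z * g (sqrt v * u)"]
    by (simp add: mult_ac)
  have "integrable lborel (\<lambda>u. ?f (0 + sqrt v * u))"
    using v by (intro lborel_integrable_real_affine[OF int]) auto
  then show "integrable std_normal_distribution (\<lambda>u. g (sqrt v * u) * exp (b * (sqrt v * u)\<^sup>2 / 2 + s * (sqrt v * u)))"
    by (subst integrable_density) (auto simp: eq)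
  have "(\<integral>t. ?f t \<partial>lborel) = sqrt v * (\<integral>u. ?f (sqrt v * u) \<partial>lborel)"
    using v lborel_integral_real_affine[of "sqrt v" ?f 0] by simp
  moreover have "(\<integral>u. g (sqrt v * u) * exp (b * (sqrt v * u)\<^sup>2 / 2 + s * (sqrt v * u)) \<partial>std_normal_distribution)
      = (\<integral>u. sqrt v * ?C * ?f (sqrt v * u) \<partial>lborel)"
    by (subst integral_density) (auto simp: eq)
  ultimately show "(\<integral>u. g (sqrt v * u) * exp (b * (sqrt v * u)\<^sup>2 / 2 + s * (sqrt v * u)) \<partial>std_normal_distribution)
      = ?C * (\<integral>t. ?f t \<partial>lborel)"
    by simp
qed

lemma AE_std_normal_not_in_finite:
  assumes "finite D"
  shows "AE x in std_normal_distribution. x \<notin> D"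
proof -
  have "AE x in lborel. x \<notin> D"
    using finite_imp_null_set_lborel[OF assms] by (rule AE_not_in)
  then show ?thesis
    by (subst AE_density) auto
qed

text \<open>A fraction \<open>d\<close> of \<open>cw_D\<close> is traded for a quadratic term,
  giving \<open>l = 1 - d\<close>. The extra summand
  \<open>\<bar>sqrt (real N) * (x - m)\<bar>\<close> makes room for test functions growing like
  \<open>exp \<bar>t\<bar>\<close>.\<close>

lemma tilt_exponent_bound:
  assumes m: "\<bar>m\<bar> < 1" and c: "c > 0"
    and max: "\<And>x. x \<in> {-1..1} \<Longrightarrow> \<beta> * power_remainder p m x - cw_D m x \<le> - c * (x - m)\<^sup>2"
  shows "\<exists>l. 0 \<le> l \<and> l < 1 \<and> (\<forall>N. \<forall>x\<in>{-1..1}.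
    real N * \<beta> * power_remainder p m x + s * (sqrt (real N) * (x - m)) + \<bar>sqrt (real N) * (x - m)\<bar>
    \<le> (\<bar>s\<bar> + 1)\<^sup>2 / c - c / 4 * (sqrt (real N) * (x - m))\<^sup>2 + l * (real N * cw_D m x))"
proof -
  obtain C where C: "C > 0" "\<And>x. x \<in> {-1..1} \<Longrightarrow> cw_D m x \<le> C * (x - m)\<^sup>2"
    using quadratic_upper_bound[OF _ continuous_on_cw_D _ tendsto_cw_D_quotient[OF m]] by auto
  \<comment> \<open>The second entry makes \<open>d * cw_D\<close> cost at most half of the gap
    \<open>c * (x - m)\<^sup>2\<close>; the first keeps \<open>1 - d\<close> nonnegative.\<close>
  define d where "d = min (1 / 2) (c / (2 * C))"
  have d: "0 < d" "d \<le> 1 / 2" "d * C \<le> c / 2"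
    using C(1) c by (auto simp: d_def min_def field_simps)
  have "real N * \<beta> * power_remainder p m x + s * (sqrt (real N) * (x - m)) + \<bar>sqrt (real N) * (x - m)\<bar>
    \<le> (\<bar>s\<bar> + 1)\<^sup>2 / c - c / 4 * (sqrt (real N) * (x - m))\<^sup>2 + (1 - d) * (real N * cw_D m x)"
    if x: "x \<in> {-1..1}" for N x
  proof -
    define w where "w = sqrt (real N) * (x - m)"
    have w2: "w\<^sup>2 = real N * (x - m)\<^sup>2"
      by (simp add: w_def power_mult_distrib)
    have "d * cw_D m x \<le> d * (C * (x - m)\<^sup>2)"
      using C(2)[OF x] d(1) by simp
    also have "\<dots> \<le> c / 2 * (x - m)\<^sup>2"
      using mult_right_mono[OF d(3), of "(x - m)\<^sup>2"] by (simp add: mult.assoc)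
    finally have "\<beta> * power_remainder p m x \<le> (1 - d) * cw_D m x - c / 2 * (x - m)\<^sup>2"
      using max[OF x] by (simp add: algebra_simps)
    then have "real N * (\<beta> * power_remainder p m x) \<le> real N * ((1 - d) * cw_D m x - c / 2 * (x - m)\<^sup>2)"
      by (rule mult_left_mono) simp
    then have 1: "real N * \<beta> * power_remainder p m x \<le> (1 - d) * (real N * cw_D m x) - c / 2 * w\<^sup>2"
      by (simp add: w2 algebra_simps)
    define k where "k = \<bar>s\<bar> + 1"
    have "s * w + \<bar>w\<bar> \<le> k * \<bar>w\<bar>"
      using abs_ge_self[of "s * w"] by (simp add: abs_mult algebra_simps k_def)
    \<comment> \<open>Expanding this square absorbs the linear term into half of the remaining
      \<open>c / 2 * w\<^sup>2\<close>, leaving the constant \<open>k\<^sup>2 / c\<close>.\<close>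
    moreover have "0 \<le> (c / 2 * \<bar>w\<bar> - k)\<^sup>2 / c"
      using c by simp
    then have "k * \<bar>w\<bar> \<le> c / 4 * w\<^sup>2 + k\<^sup>2 / c"
      using c by (simp add: power2_diff field_simps power2_eq_square)
    ultimately have "s * w + \<bar>w\<bar> \<le> c / 4 * w\<^sup>2 + k\<^sup>2 / c"
      by linarith
    with 1 show ?thesis unfolding w_def[symmetric] k_def by linarith
  qed
  with d show ?thesis by (intro exI[of _ "1 - d"]) auto
qed

lemma expectation_tilt_tendsto:
  fixes g :: "real \<Rightarrow> real" and m \<beta> s :: real and p :: nat
  defines "a \<equiv> 1 / (1 - m\<^sup>2) - \<beta> * (real p * (real (p - 1) * m ^ (p - 2)))"
  assumes m: "\<bar>m\<bar> < 1" and a: "a > 0" and c: "c > 0"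
    and max: "\<And>x. x \<in> {-1..1} \<Longrightarrow> \<beta> * power_remainder p m x - cw_D m x \<le> - c * (x - m)\<^sup>2"
    and g [measurable]: "g \<in> borel_measurable borel" and g_le: "\<And>t. \<bar>g t\<bar> \<le> exp \<bar>t\<bar>"
    and D: "finite D" "\<And>t. t \<notin> D \<Longrightarrow> isCont g t"
    and int: "integrable lborel (\<lambda>t. normal_density (s / a) (1 / sqrt a) t * g t)"
  shows "(\<lambda>N. measure_pmf.expectation (replicate_pmf N (spin_pmf m))
      (\<lambda>xs. g (sqrt (real N) * (cw_mag xs - m))
        * exp (real N * \<beta> * power_remainder p m (cw_mag xs) + s * (sqrt (real N) * (cw_mag xs - m)))))
    \<longlonglongrightarrow> exp (s\<^sup>2 / (2 * a)) / sqrt (a * (1 - m\<^sup>2)) * (\<integral>t. normal_density (s / a) (1 / sqrt a) t * g t \<partial>lborel)"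
proof -
  define v where "v = 1 - m\<^sup>2"
  have v: "v > 0" using m by (simp add: v_def abs_square_less_1)
  define b where "b = \<beta> * (real p * (real (p - 1) * m ^ (p - 2)))"
  have ab: "a = 1 / v - b" by (simp add: a_def v_def b_def)
  define Q where "Q N = measure_pmf (replicate_pmf N (spin_pmf m))" for N
  \<comment> \<open>\<open>U\<close> is the mean standardised under independent spins;
    \<open>pos\<close> inverts this for \<open>N > 0\<close>, so the density becomes the function
    \<open>\<phi> N\<close> of \<open>U N\<close> alone.\<close>
  define U where "U N xs = sqrt (real N) * (cw_mag xs - m) / sqrt v" for N xs
  define \<mu> where "\<mu> N = distr (Q N) borel (U N)" for N
  define pos where "pos N u = m + sqrt v * u / sqrt (real N)" for N and u :: real
  define \<phi> where "\<phi> N u = g (sqrt v * u) * exp (real N * \<beta> * power_remainder p m (pos N u) + s * (sqrt v * u))"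
    for N and u :: real
  define \<psi> where "\<psi> u = g (sqrt v * u) * exp (b * (sqrt v * u)\<^sup>2 / 2 + s * (sqrt v * u))" for u :: real
  have [measurable]: "power_remainder p m \<in> borel_measurable borel"
    unfolding power_remainder_def[abs_def] by measurable
  have [measurable]: "\<phi> N \<in> borel_measurable borel" for N
    unfolding \<phi>_def[abs_def] pos_def by measurable
  have [measurable]: "\<psi> \<in> borel_measurable borel"
    unfolding \<psi>_def[abs_def] by measurable
  have int_Q: "integrable (Q N) F" for N and F :: "_ \<Rightarrow> real"
    unfolding Q_def by (rule integrable_measure_pmf_finite) (simp add: set_replicate_spin_pmf[OF m])
  have [measurable]: "U N \<in> borel_measurable (Q N)" for N
    by (simp add: Q_def)
  have \<phi>_U: "\<phi> N (U N xs) = g (sqrt (real N) * (cw_mag xs - m))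
        * exp (real N * \<beta> * power_remainder p m (cw_mag xs) + s * (sqrt (real N) * (cw_mag xs - m)))"
    for N xs
    using v by (cases "N = 0") (auto simp: \<phi>_def U_def pos_def)
  have int_\<mu>: "(\<integral>u. F u \<partial>\<mu> N) = (\<integral>xs. F (U N xs) \<partial>Q N)" if [measurable]: "F \<in> borel_measurable borel"
    for N and F :: "real \<Rightarrow> real"
    unfolding \<mu>_def by (rule integral_distr) auto

  obtain l where l: "0 \<le> l" "l < 1" and expo: "\<And>N x. x \<in> {-1..1} \<Longrightarrow>
    real N * \<beta> * power_remainder p m x + s * (sqrt (real N) * (x - m)) + \<bar>sqrt (real N) * (x - m)\<bar>
    \<le> (\<bar>s\<bar> + 1)\<^sup>2 / c - c / 4 * (sqrt (real N) * (x - m))\<^sup>2 + l * (real N * cw_D m x)"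
    using tilt_exponent_bound[OF m c max, where s = s] by blast
  define K where "K = (\<bar>s\<bar> + 1)\<^sup>2 / c"
  define L where "L = 1 + 2 * exp l / (1 - exp (l - 1))"
  \<comment> \<open>Filling in the second order quotient at \<open>m\<close> gives the exact
    identity \<open>N * R = q * (sqrt v * u)\<^sup>2\<close> at \<open>pos N u\<close>. Passing to
    the limit then only needs continuity of \<open>q\<close> at \<open>m\<close>.\<close>
  define q where "q x = (if x = m then real p * (real (p - 1) * m ^ (p - 2)) / 2
      else power_remainder p m x / (x - m)\<^sup>2)" for x
  have "(q \<longlongrightarrow> real p * (real (p - 1) * m ^ (p - 2)) / 2) (at m)"
    using tendsto_power_remainder_quotient[of p m]
    by (rule Lim_transform_eventually) (auto simp: q_def eventually_at_filter)
  then have q: "isCont q m" by (simp add: isCont_def q_def)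
  have rem_q: "power_remainder p m x = q x * (x - m)\<^sup>2" for x
    by (auto simp: q_def power_remainder_def)
  have rem_pos: "real N * power_remainder p m (pos N u) = q (pos N u) * (sqrt v * u)\<^sup>2" if "N > 0" for N u
    using that by (simp add: rem_q pos_def power_divide)

  have "(\<lambda>N. \<integral>u. \<phi> N u \<partial>\<mu> N) \<longlonglongrightarrow> (\<integral>u. \<psi> u \<partial>std_normal_distribution)"
  proof (rule integral_tendsto_of_weak_conv[where E = "\<lambda>T. exp (K - c / 4 * v * T\<^sup>2) * L"])
    show "real_distribution (\<mu> n)" for n
      unfolding \<mu>_def Q_def by (rule real_distribution_distr_pmf)
    show "real_distribution std_normal_distribution" by (rule real_dist_normal_dist)
    show "weak_conv_m \<mu> std_normal_distribution"
      using weak_conv_cw_mag_replicate_spin_pmf[OF m] by (simp add: \<mu>_def[abs_def] Q_def U_def[abs_def] v_def)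
    show "AE x in std_normal_distribution. x \<noteq> z" for z
      using AE_std_normal_not_in_finite[of "{z}"] by simp
    show "AE x in std_normal_distribution. \<forall>X. X \<longlonglongrightarrow> x \<longrightarrow> (\<lambda>n. \<phi> n (X n)) \<longlonglongrightarrow> \<psi> x"
      \<comment> \<open>The discontinuities of \<open>g\<close> pull back under
        \<open>u \<mapsto> sqrt v * u\<close> to a finite set, which is null for the Gaussian
        limit.\<close>
      using AE_std_normal_not_in_finite[OF finite_imageI[OF D(1), of "\<lambda>t. t / sqrt v"]]
    proof (eventually_elim, intro allI impI)
      fix x :: real and X :: "nat \<Rightarrow> real"
      assume x: "x \<notin> (\<lambda>t. t / sqrt v) ` D" and X: "X \<longlonglongrightarrow> x"
      have "sqrt v * x \<notin> D" using x v by (auto simp: image_iff)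
      then have g_cont: "isCont g (sqrt v * x)" by (rule D(2))
      have tX: "(\<lambda>n. sqrt v * X n) \<longlonglongrightarrow> sqrt v * x"
        using X by (intro tendsto_intros)
      have "(\<lambda>n. sqrt v * X n * inverse (sqrt (real n))) \<longlonglongrightarrow> sqrt v * x * 0"
        by (intro tendsto_mult[OF tX] tendsto_inverse_0_at_top filterlim_compose[OF sqrt_at_top filterlim_real_sequentially])
      then have "(\<lambda>n. pos n (X n)) \<longlonglongrightarrow> m + 0"
        unfolding pos_def divide_inverse by (intro tendsto_intros) simp
      then have q_lim: "(\<lambda>n. q (pos n (X n))) \<longlonglongrightarrow> q m"
        using isCont_tendsto_compose[OF q] by simp
      have "(\<lambda>n. g (sqrt v * X n) * exp (\<beta> * (q (pos n (X n)) * (sqrt v * X n)\<^sup>2) + s * (sqrt v * X n)))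
        \<longlonglongrightarrow> g (sqrt v * x) * exp (\<beta> * (q m * (sqrt v * x)\<^sup>2) + s * (sqrt v * x))"
        by (intro tendsto_intros isCont_tendsto_compose[OF g_cont] tX q_lim)
      moreover have "g (sqrt v * x) * exp (\<beta> * (q m * (sqrt v * x)\<^sup>2) + s * (sqrt v * x)) = \<psi> x"
        by (simp add: \<psi>_def q_def b_def)
      moreover have "\<forall>\<^sub>F n in sequentially.
          g (sqrt v * X n) * exp (\<beta> * (q (pos n (X n)) * (sqrt v * X n)\<^sup>2) + s * (sqrt v * X n)) = \<phi> n (X n)"
        using eventually_gt_at_top[of 0]
      proof eventually_elim
        case (elim n)
        have "real n * \<beta> * power_remainder p m (pos n (X n)) = \<beta> * (q (pos n (X n)) * (sqrt v * X n)\<^sup>2)"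
          unfolding rem_pos[OF elim, symmetric] by simp
        then show ?case by (simp only: \<phi>_def)
      qed
      ultimately show "(\<lambda>n. \<phi> n (X n)) \<longlonglongrightarrow> \<psi> x"
        by (simp add: Lim_transform_eventually)
    qed
    show "\<exists>B. \<forall>n x. \<bar>x\<bar> \<le> T \<longrightarrow> \<bar>\<phi> n x\<bar> \<le> B" for T
    proof (cases "T \<ge> 0")
      case True
      \<comment> \<open>For \<open>n \<ge> 1\<close> and \<open>\<bar>x\<bar> \<le> T\<close> the
        point \<open>pos n x\<close> stays in this interval, as \<open>sqrt n \<ge> 1\<close>. The
        interval may leave \<open>{-1..1}\<close>, which is harmless for a polynomial
        remainder.\<close>
      let ?S = "{m - sqrt v * T..m + sqrt v * T}"
      have "continuous_on ?S (\<lambda>x. \<beta> * power_remainder p m x)"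
        unfolding power_remainder_def by (intro continuous_intros)
      moreover have "((\<lambda>x. \<beta> * power_remainder p m x / (x - m)\<^sup>2) \<longlongrightarrow> \<beta> * q m) (at m)"
        using tendsto_mult[OF tendsto_const[of \<beta>] tendsto_power_remainder_quotient[of p m]]
        by (simp add: q_def)
      moreover have "\<beta> * power_remainder p m m = 0"
        by (simp add: power_remainder_def)
      ultimately obtain C where C: "C > 0" "\<And>x. x \<in> ?S \<Longrightarrow> \<beta> * power_remainder p m x \<le> C * (x - m)\<^sup>2"
        using quadratic_upper_bound[of ?S "\<lambda>x. \<beta> * power_remainder p m x" m "\<beta> * q m"] compact_Icc
        by blast
      have "\<bar>\<phi> n x\<bar> \<le> exp (sqrt v * T) * exp (C * (v * T\<^sup>2) + \<bar>s\<bar> * (sqrt v * T))" if x: "\<bar>x\<bar> \<le> T" for n x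
      proof -
        have tx: "\<bar>sqrt v * x\<bar> \<le> sqrt v * T"
          using x v by (simp add: abs_mult)
        have "real n * \<beta> * power_remainder p m (pos n x) \<le> C * (v * T\<^sup>2)"
        proof (cases "n = 0")
          case True
          then show ?thesis using C(1) v by simp
        next
          case False
          then have n: "sqrt (real n) \<ge> 1" by simp
          have "\<bar>sqrt v * x / sqrt (real n)\<bar> \<le> \<bar>sqrt v * x\<bar>"
            using n by (simp add: abs_divide divide_le_eq mult_left_mono mult_le_cancel_left1)
          with tx have "\<bar>sqrt v * x / sqrt (real n)\<bar> \<le> sqrt v * T"
            by (rule order_trans[rotated])
          then have "pos n x \<in> ?S"
            unfolding pos_def atLeastAtMost_iff abs_le_iff by linarith
          then have "real n * (\<beta> * power_remainder p m (pos n x)) \<le> real n * (C * (pos n x - m)\<^sup>2)"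
            using C(2) by (intro mult_left_mono) auto
          also have "\<dots> = C * (v * x\<^sup>2)"
            using False v by (simp add: pos_def power_divide power_mult_distrib)
          also have "\<dots> \<le> C * (v * T\<^sup>2)"
            using C(1) v x True by (intro mult_left_mono) (auto simp: abs_le_square_iff[symmetric])
          finally show ?thesis by (simp add: mult.assoc)
        qed
        moreover have "s * (sqrt v * x) \<le> \<bar>s\<bar> * (sqrt v * T)"
          using abs_ge_self[of "s * (sqrt v * x)"] mult_left_mono[OF tx, of "\<bar>s\<bar>"]
          by (simp add: abs_mult)
        ultimately have "exp (real n * \<beta> * power_remainder p m (pos n x) + s * (sqrt v * x))
          \<le> exp (C * (v * T\<^sup>2) + \<bar>s\<bar> * (sqrt v * T))"
          by simp
        moreover have "\<bar>g (sqrt v * x)\<bar> \<le> exp (sqrt v * T)"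
          using g_le[of "sqrt v * x"] tx by (meson exp_le_cancel_iff order_trans)
        ultimately show ?thesis
          unfolding \<phi>_def abs_mult by (intro mult_mono) auto
      qed
      then show ?thesis by blast
    next
      case False
      then show ?thesis by (intro exI[of _ 0]) auto
    qed
    show "integrable (\<mu> n) (\<phi> n)" for n
      unfolding \<mu>_def by (subst integrable_distr_eq) (auto intro: int_Q)
    show "integrable std_normal_distribution \<psi>"
      unfolding \<psi>_def by (rule std_normal_tilt_integral(1)[OF v ab a g int])
    show "(\<integral>x. \<bar>\<phi> n x\<bar> * indicator {x. T < \<bar>x\<bar>} x \<partial>\<mu> n) \<le> exp (K - c / 4 * v * T\<^sup>2) * L" if "T > 0" for n T
    proof -
      have "(\<integral>x. \<bar>\<phi> n x\<bar> * indicator {x. T < \<bar>x\<bar>} x \<partial>\<mu> n)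
        = (\<integral>xs. \<bar>\<phi> n (U n xs)\<bar> * indicator {x. T < \<bar>x\<bar>} (U n xs) \<partial>Q n)"
        by (rule int_\<mu>) measurable
      also have "\<dots> \<le> (\<integral>xs. exp (K - c / 4 * v * T\<^sup>2) * exp (l * (real n * cw_D m (cw_mag xs))) \<partial>Q n)"
      proof (rule integral_mono_AE[OF int_Q int_Q])
        show "AE xs in Q n. \<bar>\<phi> n (U n xs)\<bar> * indicator {x. T < \<bar>x\<bar>} (U n xs)
          \<le> exp (K - c / 4 * v * T\<^sup>2) * exp (l * (real n * cw_D m (cw_mag xs)))"
          unfolding Q_def
        proof (rule AE_pmfI)
          fix xs assume "xs \<in> set_pmf (replicate_pmf n (spin_pmf m))"
          then have xs: "cw_mag xs \<in> {-1..1}"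
            by (intro cw_mag_bounds) (simp add: set_replicate_spin_pmf[OF m])
          show "\<bar>\<phi> n (U n xs)\<bar> * indicator {x. T < \<bar>x\<bar>} (U n xs)
            \<le> exp (K - c / 4 * v * T\<^sup>2) * exp (l * (real n * cw_D m (cw_mag xs)))"
          proof (cases "T < \<bar>U n xs\<bar>")
            case True
            \<comment> \<open>On the tail event \<open>?W\<^sup>2\<close> is at least
              \<open>v * T\<^sup>2\<close>, so the quadratic part of the exponent bound gives the
              factor decaying in \<open>T\<close>; the factor \<open>exp (l * N * D)\<close> left
              over has expectation at most \<open>L\<close>.\<close>
            let ?W = "sqrt (real n) * (cw_mag xs - m)"
            have "T\<^sup>2 \<le> (U n xs)\<^sup>2"
              using True that abs_le_square_iff[of T "U n xs"] by auto
            then have "v * T\<^sup>2 \<le> ?W\<^sup>2"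
              using v by (simp add: U_def power_divide field_simps)
            then have "c / 4 * (v * T\<^sup>2) \<le> c / 4 * ?W\<^sup>2"
              using c by (intro mult_left_mono) auto
            then have "real n * \<beta> * power_remainder p m (cw_mag xs) + s * ?W + \<bar>?W\<bar>
              \<le> K - c / 4 * v * T\<^sup>2 + l * (real n * cw_D m (cw_mag xs))"
              using expo[OF xs, of n] unfolding K_def by linarith
            then have "exp \<bar>?W\<bar> * exp (real n * \<beta> * power_remainder p m (cw_mag xs) + s * ?W)
              \<le> exp (K - c / 4 * v * T\<^sup>2) * exp (l * (real n * cw_D m (cw_mag xs)))"
              by (simp flip: exp_add add: add_ac)
            moreover have "\<bar>\<phi> n (U n xs)\<bar> \<le> exp \<bar>?W\<bar> * exp (real n * \<beta> * power_remainder p m (cw_mag xs) + s * ?W)"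
              unfolding \<phi>_U abs_mult[of "g ?W"] by (intro mult_mono g_le) auto
            ultimately show ?thesis using True by simp
          qed simp
        qed
      qed
      also have "\<dots> = exp (K - c / 4 * v * T\<^sup>2) * (\<integral>xs. exp (l * (real n * cw_D m (cw_mag xs))) \<partial>Q n)"
        by simp
      also have "\<dots> \<le> exp (K - c / 4 * v * T\<^sup>2) * L"
        unfolding Q_def L_def by (intro mult_left_mono exp_moment_cw_D[OF m l]) simp
      finally show ?thesis .
    qed
    define e where "e = c / 4 * v"
    have "e > 0" using c v by (simp add: e_def)
    then have "((\<lambda>T. exp (K - e * T\<^sup>2)) \<longlongrightarrow> 0) at_top"
      by real_asymp
    then show "((\<lambda>T. exp (K - c / 4 * v * T\<^sup>2) * L) \<longlongrightarrow> 0) at_top"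
      unfolding e_def by (rule tendsto_mult_left_zero)
  qed measurable
  moreover have "(\<integral>u. \<phi> N u \<partial>\<mu> N) = measure_pmf.expectation (replicate_pmf N (spin_pmf m))
      (\<lambda>xs. g (sqrt (real N) * (cw_mag xs - m))
        * exp (real N * \<beta> * power_remainder p m (cw_mag xs) + s * (sqrt (real N) * (cw_mag xs - m))))" for N
    by (subst int_\<mu>) (simp_all add: \<phi>_U Q_def)
  moreover have "(\<integral>u. \<psi> u \<partial>std_normal_distribution)
    = exp (s\<^sup>2 / (2 * a)) / sqrt (a * (1 - m\<^sup>2)) * (\<integral>t. normal_density (s / a) (1 / sqrt a) t * g t \<partial>lborel)"
    unfolding \<psi>_def v_def[symmetric] by (rule std_normal_tilt_integral(2)[OF v ab a g int])
  ultimately show ?thesis by simp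
qed

section \<open>The maximum likelihood estimate\<close>

lemma has_real_derivative_exp_sum:
  fixes c d :: "'a \<Rightarrow> real"
  shows "((\<lambda>t. \<Sum>y\<in>S. c y * exp (t * d y)) has_real_derivative (\<Sum>y\<in>S. c y * d y * exp (t * d y))) (at t)"
  by (auto intro!: derivative_eq_intros sum.cong)

text \<open>Each summand \<open>c y * d y * exp (t * d y)\<close> increases in \<open>t\<close> for
  either sign of \<open>d y\<close>, and is constant only if \<open>d y = 0\<close>.\<close>

lemma exp_sum_deriv_strict_mono:
  fixes c d :: "'a \<Rightarrow> real"
  assumes "finite S" and "\<And>y. y \<in> S \<Longrightarrow> 0 < c y" and "a \<in> S" "d a \<noteq> 0" and "t < u"
  shows "(\<Sum>y\<in>S. c y * d y * exp (t * d y)) < (\<Sum>y\<in>S. c y * d y * exp (u * d y))"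
proof (rule sum_strict_mono_ex1)
  have strict: "c y * d y * exp (t * d y) < c y * d y * exp (u * d y)" if "y \<in> S" "d y \<noteq> 0" for y
  proof (cases "d y > 0")
    case True
    then show ?thesis using assms(2)[OF that(1)] assms(5) by simp
  next
    case False
    then have "d y < 0" using that(2) by simp
    moreover from this have "exp (u * d y) < exp (t * d y)" using assms(5) by simp
    ultimately show ?thesis
      using assms(2)[OF that(1)] by (intro mult_strict_left_mono_neg) (auto simp: mult_less_0_iff)
  qed
  show "\<forall>y\<in>S. c y * d y * exp (t * d y) \<le> c y * d y * exp (u * d y)"
    using strict by (metis less_eq_real_def mult_zero_left mult_zero_right)
  show "\<exists>y\<in>S. c y * d y * exp (t * d y) < c y * d y * exp (u * d y)"
    using strict assms(3,4) by blast
qed (rule assms(1))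

lemma exp_sum_deriv_pos_ex:
  fixes c d :: "'a \<Rightarrow> real"
  assumes fin: "finite S" and c: "\<And>y. y \<in> S \<Longrightarrow> 0 < c y" and b: "b \<in> S" "0 < d b"
  shows "\<exists>t. 0 < (\<Sum>y\<in>S. c y * d y * exp (t * d y))"
proof -
  define B where "B = (\<Sum>y\<in>S - {b}. c y * \<bar>d y\<bar>)"
  have B: "0 \<le> B" unfolding B_def by (intro sum_nonneg) (auto simp: c less_imp_le)
  \<comment> \<open>Chosen so that \<open>exp z \<ge> 1 + z\<close> makes the term of
    \<open>b\<close> at least \<open>c b * d b + B\<close>, while for \<open>t \<ge> 0\<close> all
    other terms together are at least \<open>- B\<close>.\<close>
  define t where "t = B / (c b * d b) / d b"
  have t: "0 \<le> t" using B b c[OF b(1)] by (simp add: t_def)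
  have "- B \<le> (\<Sum>y\<in>S - {b}. c y * d y * exp (t * d y))"
    unfolding B_def sum_negf[symmetric]
  proof (rule sum_mono)
    fix y assume y: "y \<in> S - {b}"
    have "- \<bar>d y\<bar> \<le> d y * exp (t * d y)"
    proof (cases "0 \<le> d y")
      case False
      then have "exp (t * d y) \<le> 1" using t by (simp add: mult_nonneg_nonpos)
      then have "d y * 1 \<le> d y * exp (t * d y)"
        using False by (intro mult_left_mono_neg) auto
      then show ?thesis using False by simp
    qed (smt (verit) exp_gt_zero mult_nonneg_nonneg)
    then have "c y * - \<bar>d y\<bar> \<le> c y * (d y * exp (t * d y))"
      using c[of y] y by (intro mult_left_mono) auto
    then show "- (c y * \<bar>d y\<bar>) \<le> c y * d y * exp (t * d y)"
      by (simp add: mult.assoc)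
  qed
  moreover have "c b * d b * (1 + t * d b) \<le> c b * d b * exp (t * d b)"
    using c[OF b(1)] b(2) by (intro mult_left_mono exp_ge_add_one_self) auto
  moreover have "c b * d b * (1 + t * d b) = c b * d b + B"
    using c[OF b(1)] b(2) by (simp add: t_def field_simps)
  moreover have "0 < c b * d b" using c[OF b(1)] b(2) by simp
  moreover have "(\<Sum>y\<in>S. c y * d y * exp (t * d y))
      = c b * d b * exp (t * d b) + (\<Sum>y\<in>S - {b}. c y * d y * exp (t * d y))"
    using fin b(1) by (rule sum.remove)
  ultimately have "0 < (\<Sum>y\<in>S. c y * d y * exp (t * d y))" by linarith
  then show ?thesis ..
qed

text \<open>Exponents of both signs force the derivative to take both signs; the negative value
  comes from reflecting \<open>t\<close> and \<open>d\<close>. Being continuous and strictly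
  increasing, the derivative has a single zero, and its sign at \<open>t\<close> tells on which side
  of the minimiser \<open>t\<close> lies.\<close>

lemma exp_sum_minimiser:
  fixes c d :: "'a \<Rightarrow> real"
  assumes fin: "finite S" and c: "\<And>y. y \<in> S \<Longrightarrow> 0 < c y" and b: "b \<in> S" "0 < d b" and a: "a \<in> S" "d a < 0"
  obtains h where "\<And>t. t \<noteq> h \<Longrightarrow> (\<Sum>y\<in>S. c y * exp (h * d y)) < (\<Sum>y\<in>S. c y * exp (t * d y))"
    and "\<And>t. h \<le> t \<longleftrightarrow> 0 \<le> (\<Sum>y\<in>S. c y * d y * exp (t * d y))"
proof -
  define G where "G t = (\<Sum>y\<in>S. c y * exp (t * d y))" for t
  define G' where "G' t = (\<Sum>y\<in>S. c y * d y * exp (t * d y))" for t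
  have deriv: "(G has_real_derivative G' t) (at t)" for t
    unfolding G_def G'_def by (rule has_real_derivative_exp_sum)
  have mono: "G' t < G' u" if "t < u" for t u
    unfolding G'_def using exp_sum_deriv_strict_mono[OF fin c b(1) _ that] b(2) by simp
  obtain t1 where t1: "0 < G' t1"
    using exp_sum_deriv_pos_ex[of S c b d, OF fin c b] by (auto simp: G'_def)
  obtain t0 where "0 < (\<Sum>y\<in>S. c y * - d y * exp (t0 * - d y))"
    using exp_sum_deriv_pos_ex[of S c a "\<lambda>y. - d y", OF fin c a(1)] a(2) by auto
  then have t0: "G' (- t0) < 0" by (simp add: G'_def sum_negf)
  have "- t0 \<le> t1" using mono[of t1 "- t0"] t0 t1 by (cases "t1 < - t0") auto
  moreover have "continuous_on {- t0..t1} G'"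
    unfolding G'_def by (intro continuous_intros)
  ultimately obtain h where h: "G' h = 0"
    using IVT'[of G' "- t0" 0 t1] t0 t1 by auto
  show thesis
  proof (rule that[of h], unfold G_def[symmetric] G'_def[symmetric])
    fix t
    show "h \<le> t \<longleftrightarrow> 0 \<le> G' t"
      using mono[of h t] mono[of t h] h by (cases h t rule: linorder_cases) auto
    assume "t \<noteq> h"
    then consider "h < t" | "t < h" by linarith
    then show "G h < G t"
    proof cases
      case 1
      from MVT2[OF this deriv] obtain z where "h < z" "G t - G h = (t - h) * G' z" by blast
      then show ?thesis using mono[of h z] h 1 mult_pos_pos[of "t - h" "G' z"] by linarith
    next
      case 2
      from MVT2[OF this deriv] obtain z where "z < h" "G h - G t = (h - t) * G' z" by blast
      then show ?thesis using mono[of z h] h 2 mult_pos_neg[of "h - t" "G' z"] by linarith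
    qed
  qed
qed

section \<open>The likelihood as a function of the field\<close>

lemma cw_weight_pos: "0 < cw_weight N \<beta> h p xs"
  by (simp add: cw_weight_def)

lemma cw_conf_nonempty: "cw_conf N \<noteq> {}"
proof -
  have "replicate N 1 \<in> cw_conf N" by (auto simp: cw_conf_def)
  then show ?thesis by blast
qed

lemma sum_cw_weight_pos: "0 < (\<Sum>ys\<in>cw_conf N. cw_weight N \<beta> h p ys)"
  by (intro sum_pos cw_weight_pos finite_cw_conf cw_conf_nonempty)

lemma pmf_cw_pmf:
  "pmf (cw_pmf N \<beta> h p) xs = (if xs \<in> cw_conf N
     then cw_weight N \<beta> h p xs / (\<Sum>ys\<in>cw_conf N. cw_weight N \<beta> h p ys) else 0)"
proof -
  let ?f = "\<lambda>xs. if xs \<in> cw_conf N then cw_weight N \<beta> h p xs / (2 ^ N * cw_Z N \<beta> h p) else 0"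
  let ?T = "\<Sum>ys\<in>cw_conf N. cw_weight N \<beta> h p ys"
  have Z: "2 ^ N * cw_Z N \<beta> h p = ?T" by (simp add: cw_Z_def)
  have nonneg: "0 \<le> ?f xs" for xs
    using sum_cw_weight_pos[of N \<beta> h p] cw_weight_pos[of N \<beta> h p xs] by (simp add: Z less_imp_le)
  have "(\<integral>\<^sup>+xs. ennreal (?f xs) \<partial>count_space UNIV) = (\<integral>\<^sup>+xs. ennreal (?f xs) \<partial>count_space (cw_conf N))"
    by (subst nn_integral_count_space_indicator) (auto intro!: nn_integral_cong simp: indicator_def)
  also have "\<dots> = ennreal (\<Sum>xs\<in>cw_conf N. ?f xs)"
    unfolding nn_integral_count_space_finite[OF finite_cw_conf] by (intro sum_ennreal nonneg)
  also have "(\<Sum>xs\<in>cw_conf N. ?f xs) = 1"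
    using sum_cw_weight_pos[of N \<beta> h p] by (simp add: Z flip: sum_divide_distrib)
  finally have "(\<integral>\<^sup>+xs. ennreal (?f xs) \<partial>count_space UNIV) = 1" by simp
  from pmf_embed_pmf[of ?f, OF nonneg this] show ?thesis
    by (simp only: cw_pmf_def Z)
qed

text \<open>The quotient of unnormalised sums has the form compared with independent spins in
  \<open>cw_ratio_eq_tilt\<close>.\<close>

definition cw_mean :: "nat \<Rightarrow> real \<Rightarrow> real \<Rightarrow> nat \<Rightarrow> real" where
  "cw_mean N \<beta> h p = (\<Sum>ys\<in>cw_conf N. cw_weight N \<beta> h p ys * cw_mag ys) / (\<Sum>ys\<in>cw_conf N. cw_weight N \<beta> h p ys)"

text \<open>Dividing all weights by that of \<open>xs\<close> shows that the likelihood at field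
  \<open>t\<close> is \<open>1 / G t\<close>, with \<open>G\<close> a positive sum of exponentials.
  The sign of \<open>G' t\<close> is that of \<open>cw_mean N \<beta> t p - cw_mag xs\<close>, so
  the position of the minimiser of \<open>G\<close> is read off from the mean.\<close>

lemma cw_mle_le_iff:
  assumes N: "N > 0" and xs: "xs \<in> cw_conf N"
  shows "cw_mle N \<beta> p xs \<le> ereal t \<longleftrightarrow> cw_mag xs \<le> cw_mean N \<beta> t p"
proof -
  let ?S = "cw_conf N"
  define c where "c ys = exp (real N * \<beta> * (cw_mag ys ^ p - cw_mag xs ^ p))" for ys
  define d where "d ys = real N * (cw_mag ys - cw_mag xs)" for ys
  define G where "G t = (\<Sum>ys\<in>?S. c ys * exp (t * d ys))" for t
  define G' where "G' t = (\<Sum>ys\<in>?S. c ys * d ys * exp (t * d ys))" for t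
  have c: "0 < c ys" for ys by (simp add: c_def)
  have weight: "cw_weight N \<beta> t p ys = cw_weight N \<beta> t p xs * (c ys * exp (t * d ys))" for t ys
    by (simp add: cw_weight_def c_def d_def algebra_simps flip: exp_add)
  have G_pos: "0 < G t" for t
    unfolding G_def by (intro sum_pos finite_cw_conf cw_conf_nonempty) (simp add: c)
  have total: "(\<Sum>ys\<in>?S. cw_weight N \<beta> t p ys) = cw_weight N \<beta> t p xs * G t" for t
    unfolding G_def sum_distrib_left by (intro sum.cong refl weight)
  have pmf: "pmf (cw_pmf N \<beta> t p) xs = 1 / G t" for t
    using xs cw_weight_pos[of N \<beta> t p xs] by (simp add: pmf_cw_pmf total)
  have argmax: "is_arg_max (\<lambda>h. pmf (cw_pmf N \<beta> h p) xs) (\<lambda>_. True) h \<longleftrightarrow> (\<forall>t. G h \<le> G t)" for h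
    unfolding is_arg_max_def pmf using G_pos by (auto simp: not_less frac_le_eq divide_le_eq field_simps)
  have mean: "cw_mag xs \<le> cw_mean N \<beta> t p \<longleftrightarrow> 0 \<le> G' t" for t
  proof -
    let ?w = "cw_weight N \<beta> t p"
    have "?w xs * G' t = (\<Sum>ys\<in>?S. ?w ys * d ys)"
      unfolding G'_def sum_distrib_left by (intro sum.cong refl) (subst weight, simp)
    also have "\<dots> = real N * ((\<Sum>ys\<in>?S. ?w ys * cw_mag ys) - cw_mag xs * (\<Sum>ys\<in>?S. ?w ys))"
      by (simp add: d_def sum_distrib_left sum_subtractf algebra_simps)
    also have "(\<Sum>ys\<in>?S. ?w ys * cw_mag ys) = cw_mean N \<beta> t p * (\<Sum>ys\<in>?S. ?w ys)"
      using sum_cw_weight_pos[of N \<beta> t p] by (simp add: cw_mean_def)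
    finally have "?w xs * G' t = real N * (\<Sum>ys\<in>?S. ?w ys) * (cw_mean N \<beta> t p - cw_mag xs)"
      by (simp add: algebra_simps)
    moreover have "0 < real N * (\<Sum>ys\<in>?S. ?w ys)"
      using N sum_cw_weight_pos by simp
    ultimately show ?thesis
      using cw_weight_pos[of N \<beta> t p xs]
      by (metis diff_ge_0_iff_ge zero_le_mult_iff less_le_not_le)
  qed
  have deriv: "(G has_real_derivative G' t) (at t)" for t
    unfolding G_def G'_def by (rule has_real_derivative_exp_sum)
  have ends: "replicate N 1 \<in> ?S" "replicate N (-1) \<in> ?S"
    by (auto simp: cw_conf_def)
  have d_ends: "d (replicate N 1) = real N * (1 - cw_mag xs)" "d (replicate N (-1)) = - real N * (1 + cw_mag xs)"
    using N by (simp_all add: d_def cw_mag_def sum_list_replicate algebra_simps)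
  consider "\<bar>cw_mag xs\<bar> < 1" | "cw_mag xs = 1" | "cw_mag xs = -1"
    using cw_mag_bounds[OF xs] by fastforce
  then show ?thesis
  proof cases
    case 1
    \<comment> \<open>The two constant configurations supply exponents of both signs, since
      \<open>cw_mag xs\<close> lies strictly between -1 and 1.\<close>
    obtain h where h: "\<And>t. t \<noteq> h \<Longrightarrow> G h < G t" "\<And>t. h \<le> t \<longleftrightarrow> 0 \<le> G' t"
      unfolding G_def G'_def
      by (rule exp_sum_minimiser[of ?S c "replicate N 1" d "replicate N (-1)"])
        (use N 1 ends c in \<open>auto simp: d_ends abs_less_iff mult_less_0_iff\<close>)
    have "is_arg_max (\<lambda>h. pmf (cw_pmf N \<beta> h p) xs) (\<lambda>_. True) = (\<lambda>t. t = h)"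
      unfolding fun_eq_iff argmax using h(1) by (metis less_le_not_le order_refl)
    then have "cw_mle N \<beta> p xs = ereal h"
      by (simp add: cw_mle_def)
    then show ?thesis using h(2) mean by simp
  next
    case 2
    \<comment> \<open>No exponent is positive, so \<open>G\<close> strictly decreases and no
      maximiser of the likelihood exists. The estimate is then infinite and both sides of the
      equivalence are false; in the case of mean -1 both are true.\<close>
    have "G' t < 0" for t
    proof -
      have "G' t < (\<Sum>ys\<in>?S. 0)"
        unfolding G'_def
      proof (rule sum_strict_mono_ex1)
        show "\<forall>ys\<in>?S. c ys * d ys * exp (t * d ys) \<le> 0"
          using cw_mag_bounds c by (auto simp: d_def 2 mult_le_0_iff less_imp_le zero_le_mult_iff)
        show "\<exists>ys\<in>?S. c ys * d ys * exp (t * d ys) < 0"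
          by (rule bexI[OF _ ends(2)]) (use N c in \<open>auto simp: d_ends 2 mult_less_0_iff\<close>)
      qed simp
      then show ?thesis by simp
    qed
    then have "G t < G u" if "u < t" for t u
      using DERIV_neg_imp_decreasing[OF that, of G] deriv by blast
    then have "\<not> is_arg_max (\<lambda>h. pmf (cw_pmf N \<beta> h p) xs) (\<lambda>_. True) h" for h
      unfolding argmax by (metis gt_ex leD)
    then have "cw_mle N \<beta> p xs = \<infinity>"
      by (simp add: cw_mle_def 2 Ex1_def)
    then show ?thesis using \<open>\<And>t. G' t < 0\<close>[of t] mean[of t] by simp
  next
    case 3
    have "0 < G' t" for t
    proof -
      have "(\<Sum>ys\<in>?S. 0) < G' t"
        unfolding G'_def
      proof (rule sum_strict_mono_ex1)
        show "\<forall>ys\<in>?S. 0 \<le> c ys * d ys * exp (t * d ys)"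
          using cw_mag_bounds c by (auto simp: d_def 3 less_imp_le intro!: mult_nonneg_nonneg) force
        show "\<exists>ys\<in>?S. 0 < c ys * d ys * exp (t * d ys)"
          by (rule bexI[OF _ ends(1)]) (use N c in \<open>auto simp: d_ends 3\<close>)
      qed simp
      then show ?thesis by simp
    qed
    then have "G u < G t" if "u < t" for t u
      using DERIV_pos_imp_increasing[OF that, of G] deriv by blast
    then have "\<not> is_arg_max (\<lambda>h. pmf (cw_pmf N \<beta> h p) xs) (\<lambda>_. True) h" for h
      unfolding argmax by (metis lt_ex leD)
    then have "cw_mle N \<beta> p xs = - \<infinity>"
      by (simp add: cw_mle_def 3 Ex1_def)
    then show ?thesis using \<open>\<And>t. 0 < G' t\<close>[of t] mean[of t] by simp
  qed
qed

text \<open>Also valid at infinite \<open>z\<close>: with \<open>r > 0\<close> finite, an infinite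
  estimate keeps its sign under centring and scaling.\<close>

lemma ereal_scaled_diff_le_iff:
  assumes "0 < r"
  shows "ereal r * (z - ereal h) \<le> ereal x \<longleftrightarrow> z \<le> ereal (h + x / r)"
  using assms by (cases z) (auto simp: field_simps)

lemma scaled_cw_mle_le_iff:
  assumes "N > 0" and "xs \<in> cw_conf N"
  shows "ereal (sqrt (real N)) * (cw_mle N \<beta> p xs - ereal h) \<le> ereal x
    \<longleftrightarrow> cw_mag xs \<le> cw_mean N \<beta> (h + x / sqrt (real N)) p"
  using assms by (subst ereal_scaled_diff_le_iff) (auto simp: cw_mle_le_iff)

section \<open>Asymptotics of the Curie--Weiss model\<close>

text \<open>By \<open>crit\<close> the linear coefficient
  \<open>\<beta> * p * m ^ (p - 1) + h\<close> equals \<open>artanh m\<close>, the natural parameter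
  of spins of mean \<open>m\<close>. What remains is the remainder of the power and the shift of the
  field, up to a constant \<open>\<kappa>\<close> that cancels in quotients.\<close>

lemma cw_weight_eq_tilt:
  assumes m: "\<bar>m\<bar> < 1" and crit: "\<beta> * (real p * m ^ (p - 1)) + h - artanh m = 0"
    and N: "N > 0"
  obtains \<kappa> where "\<kappa> > 0" and "\<And>xs. xs \<in> cw_conf N \<Longrightarrow> cw_weight N \<beta> (h + s / sqrt (real N)) p xs
    = \<kappa> * (pmf (replicate_pmf N (spin_pmf m)) xs
      * exp (real N * \<beta> * power_remainder p m (cw_mag xs) + s * (sqrt (real N) * (cw_mag xs - m))))"
proof -
  \<comment> \<open>Collects everything independent of \<open>xs\<close>: the constant part of the
    Taylor polynomial, the centring of \<open>s * W\<close> and the normalisation of the spin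
    law.\<close>
  define k where "k = real N * \<beta> * (m ^ p - real p * m ^ (p - 1) * m) + s * (sqrt (real N) * m)
    - real N * (ln (1 - m\<^sup>2) / 2 - ln 2)"
  show thesis
  proof (rule that[of "exp k"])
    fix xs assume xs: "xs \<in> cw_conf N"
    have art: "artanh m = \<beta> * (real p * m ^ (p - 1)) + h" using crit by simp
    have sq: "real N * (s / sqrt (real N)) = s * sqrt (real N)"
      using N by (simp add: field_simps)
    have "real N * (\<beta> * cw_mag xs ^ p + (h + s / sqrt (real N)) * cw_mag xs)
      = real N * \<beta> * cw_mag xs ^ p + real N * h * cw_mag xs + real N * (s / sqrt (real N)) * cw_mag xs"
      by (simp add: algebra_simps)
    also have "\<dots> = k + (real N * (ln (1 - m\<^sup>2) / 2 - ln 2) + artanh m * (real N * cw_mag xs)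
      + (real N * \<beta> * power_remainder p m (cw_mag xs) + s * (sqrt (real N) * (cw_mag xs - m))))"
      unfolding sq art k_def power_remainder_def by (simp add: algebra_simps)
    finally show "cw_weight N \<beta> (h + s / sqrt (real N)) p xs
    = exp k * (pmf (replicate_pmf N (spin_pmf m)) xs
      * exp (real N * \<beta> * power_remainder p m (cw_mag xs) + s * (sqrt (real N) * (cw_mag xs - m))))"
      unfolding cw_weight_def pmf_replicate_spin_pmf[OF m xs] cw_mag_scaled[OF xs, symmetric]
      by (simp only: exp_add[symmetric] add.assoc)
  qed simp
qed

lemma cw_ratio_eq_tilt:
  fixes m \<beta> h s :: real and F :: "int list \<Rightarrow> real"
  assumes m: "\<bar>m\<bar> < 1" and crit: "\<beta> * (real p * m ^ (p - 1)) + h - artanh m = 0" and N: "N > 0"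
  defines "E \<equiv> \<lambda>F. measure_pmf.expectation (replicate_pmf N (spin_pmf m))
      (\<lambda>xs. F xs * exp (real N * \<beta> * power_remainder p m (cw_mag xs) + s * (sqrt (real N) * (cw_mag xs - m))))"
  shows "(\<Sum>xs\<in>cw_conf N. cw_weight N \<beta> (h + s / sqrt (real N)) p xs * F xs)
      / (\<Sum>xs\<in>cw_conf N. cw_weight N \<beta> (h + s / sqrt (real N)) p xs) = E F / E (\<lambda>_. 1)"
proof -
  obtain \<kappa> where \<kappa>: "\<kappa> > 0" "\<And>xs. xs \<in> cw_conf N \<Longrightarrow> cw_weight N \<beta> (h + s / sqrt (real N)) p xs
    = \<kappa> * (pmf (replicate_pmf N (spin_pmf m)) xs
      * exp (real N * \<beta> * power_remainder p m (cw_mag xs) + s * (sqrt (real N) * (cw_mag xs - m))))"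
    using cw_weight_eq_tilt[OF m crit N] by blast
  have "(\<Sum>xs\<in>cw_conf N. cw_weight N \<beta> (h + s / sqrt (real N)) p xs * F xs) = \<kappa> * E F" for F
    unfolding E_def expectation_replicate_spin_pmf[OF m] sum_distrib_left
    by (intro sum.cong) (simp_all add: \<kappa>(2) mult_ac)
  from this[of F] this[of "\<lambda>_. 1"] show ?thesis
    using \<kappa>(1) by simp
qed

locale cw_critical =
  fixes \<beta> h m :: real and p :: nat
  assumes m: "\<bar>m\<bar> < 1"
    and crit: "\<beta> * (real p * m ^ (p - 1)) + h - artanh m = 0"
    and strict_max: "\<And>x. x \<in> {-1..1} \<Longrightarrow> x \<noteq> m \<Longrightarrow> cw_H \<beta> h p x < cw_H \<beta> h p m"
    and curv: "deriv (deriv (cw_H \<beta> h p)) m < 0"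
begin

definition curvature :: real where
  "curvature = 1 / (1 - m\<^sup>2) - \<beta> * (real p * (real (p - 1) * m ^ (p - 2)))"

lemma curvature_eq: "curvature = - deriv (deriv (cw_H \<beta> h p)) m"
  by (simp add: curvature_def deriv_deriv_cw_H[OF m])

lemma curvature_pos: "curvature > 0"
  using curv by (simp add: curvature_eq)

text \<open>Stationarity cancels the linear terms, so the strict maximum of \<open>cw_H\<close> is
  negativity of \<open>\<beta> * R - D\<close> away from \<open>m\<close>.\<close>

lemma cw_H_diff: "\<beta> * power_remainder p m x - cw_D m x = cw_H \<beta> h p x - cw_H \<beta> h p m"
proof -
  have "artanh m = \<beta> * (real p * m ^ (p - 1)) + h" using crit by simp
  then show ?thesis
    unfolding power_remainder_def cw_D_def cw_H_def by (simp add: algebra_simps)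
qed

lemma cw_H_quadratic:
  obtains c where "c > 0"
    and "\<And>x. x \<in> {-1..1} \<Longrightarrow> \<beta> * power_remainder p m x - cw_D m x \<le> - c * (x - m)\<^sup>2"
proof -
  let ?f = "\<lambda>x. \<beta> * power_remainder p m x - cw_D m x"
  have "((\<lambda>x. \<beta> * (power_remainder p m x / (x - m)\<^sup>2) - cw_D m x / (x - m)\<^sup>2) \<longlongrightarrow>
      \<beta> * (real p * (real (p - 1) * m ^ (p - 2)) / 2) - 1 / (1 - m\<^sup>2) / 2) (at m)"
    by (intro tendsto_intros tendsto_power_remainder_quotient tendsto_cw_D_quotient m)
  then have lim: "((\<lambda>x. ?f x / (x - m)\<^sup>2) \<longlongrightarrow> - curvature / 2) (at m)"
    by (simp add: curvature_def diff_divide_distrib)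
  have cont: "continuous_on {-1..1} ?f"
    unfolding power_remainder_def by (intro continuous_intros continuous_on_cw_D)
  have zero: "?f m = 0" by (simp add: power_remainder_def)
  have mem: "m \<in> {-1..1}" using m by (auto simp: abs_less_iff)
  have neg: "?f x < 0" if "x \<in> {-1..1}" "x \<noteq> m" for x
    using strict_max[OF that] by (simp only: cw_H_diff)
  have "- curvature / 2 < 0" using curvature_pos by simp
  from quadratic_upper_bound_neg[OF compact_Icc mem cont zero lim this neg]
  obtain c where "c > 0" "\<forall>x\<in>{-1..1}. ?f x \<le> - c * (x - m)\<^sup>2"
    by blast
  then show thesis using that by blast
qed

lemma expectation_ratio_tendsto:
  fixes g :: "real \<Rightarrow> real"
  assumes g: "g \<in> borel_measurable borel" and g_le: "\<And>t. \<bar>g t\<bar> \<le> exp \<bar>t\<bar>"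
    and D: "finite D" "\<And>t. t \<notin> D \<Longrightarrow> isCont g t"
    and int: "integrable lborel (\<lambda>t. normal_density (s / curvature) (1 / sqrt curvature) t * g t)"
  shows "(\<lambda>N. (\<Sum>xs\<in>cw_conf N. cw_weight N \<beta> (h + s / sqrt (real N)) p xs * g (sqrt (real N) * (cw_mag xs - m)))
      / (\<Sum>xs\<in>cw_conf N. cw_weight N \<beta> (h + s / sqrt (real N)) p xs))
    \<longlonglongrightarrow> (\<integral>t. normal_density (s / curvature) (1 / sqrt curvature) t * g t \<partial>lborel)"
proof -
  obtain c where c: "c > 0"
    "\<And>x. x \<in> {-1..1} \<Longrightarrow> \<beta> * power_remainder p m x - cw_D m x \<le> - c * (x - m)\<^sup>2"
    using cw_H_quadratic by blast
  let ?C = "exp (s\<^sup>2 / (2 * curvature)) / sqrt (curvature * (1 - m\<^sup>2))"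
  let ?I = "\<lambda>g. \<integral>t. normal_density (s / curvature) (1 / sqrt curvature) t * g t \<partial>lborel"
  define E where "E N g = measure_pmf.expectation (replicate_pmf N (spin_pmf m))
      (\<lambda>xs. g (sqrt (real N) * (cw_mag xs - m))
        * exp (real N * \<beta> * power_remainder p m (cw_mag xs) + s * (sqrt (real N) * (cw_mag xs - m))))" for N g
  \<comment> \<open>Applied to \<open>g\<close> and to the constant 1, it gives the same prefactor
    \<open>?C\<close>, which drops out of the quotient.\<close>
  note tilt = expectation_tilt_tendsto[where s = s, OF m curvature_pos[unfolded curvature_def] c, folded curvature_def, folded E_def]
  have "(\<lambda>N. E N g) \<longlonglongrightarrow> ?C * ?I g"
    by (rule tilt) (assumption | fact g g_le D int)+
  moreover have "(\<lambda>N. E N (\<lambda>_. 1)) \<longlonglongrightarrow> ?C * ?I (\<lambda>_. 1)"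
    using curvature_pos by (intro tilt[where g = "\<lambda>_. 1" and D = "{}"]) auto
  moreover have "?I (\<lambda>_. 1) = 1"
    using curvature_pos by simp
  moreover have C: "?C \<noteq> 0"
    using curvature_pos m by (simp add: abs_square_eq_1)
  ultimately have "(\<lambda>N. E N g / E N (\<lambda>_. 1)) \<longlonglongrightarrow> ?C * ?I g / ?C"
    by (intro tendsto_divide) simp_all
  then have "(\<lambda>N. E N g / E N (\<lambda>_. 1)) \<longlonglongrightarrow> ?I g"
    using C by simp
  moreover have "\<forall>\<^sub>F N in sequentially. E N g / E N (\<lambda>_. 1) =
      (\<Sum>xs\<in>cw_conf N. cw_weight N \<beta> (h + s / sqrt (real N)) p xs * g (sqrt (real N) * (cw_mag xs - m)))
      / (\<Sum>xs\<in>cw_conf N. cw_weight N \<beta> (h + s / sqrt (real N)) p xs)"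
    using eventually_gt_at_top[of 0]
    by eventually_elim (simp add: E_def cw_ratio_eq_tilt[OF m crit])
  ultimately show ?thesis
    by (rule Lim_transform_eventually)
qed

lemma cw_mean_tendsto:
  "(\<lambda>N. sqrt (real N) * (cw_mean N \<beta> (h + s / sqrt (real N)) p - m)) \<longlonglongrightarrow> s / curvature"
proof -
  have sd: "0 < 1 / sqrt curvature" using curvature_pos by simp
  have "(\<lambda>N. (\<Sum>xs\<in>cw_conf N. cw_weight N \<beta> (h + s / sqrt (real N)) p xs * (sqrt (real N) * (cw_mag xs - m)))
      / (\<Sum>xs\<in>cw_conf N. cw_weight N \<beta> (h + s / sqrt (real N)) p xs))
    \<longlonglongrightarrow> (\<integral>t. normal_density (s / curvature) (1 / sqrt curvature) t * t \<partial>lborel)"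
  proof (rule expectation_ratio_tendsto[where D = "{}"])
    show "\<bar>t\<bar> \<le> exp \<bar>t\<bar>" for t :: real
      using exp_ge_add_one_self[of "\<bar>t\<bar>"] by linarith
  qed (auto intro: integrable_normal_moment_nz_1[OF sd])
  moreover have "(\<Sum>xs\<in>cw_conf N. cw_weight N \<beta> t p xs * (sqrt (real N) * (cw_mag xs - m)))
      / (\<Sum>xs\<in>cw_conf N. cw_weight N \<beta> t p xs) = sqrt (real N) * (cw_mean N \<beta> t p - m)" for N t
  proof -
    have "(\<Sum>xs\<in>cw_conf N. cw_weight N \<beta> t p xs * (sqrt (real N) * (cw_mag xs - m)))
      = sqrt (real N) * ((\<Sum>xs\<in>cw_conf N. cw_weight N \<beta> t p xs * cw_mag xs) - m * (\<Sum>xs\<in>cw_conf N. cw_weight N \<beta> t p xs))"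
      by (simp add: sum_distrib_left sum_subtractf algebra_simps)
    then show ?thesis
      using sum_cw_weight_pos[of N \<beta> t p] by (simp add: cw_mean_def field_simps)
  qed
  ultimately show ?thesis
    by (simp add: integral_normal_moment_nz_1[OF sd])
qed

lemma cw_mag_clt:
  "(\<lambda>N. measure_pmf.prob (cw_pmf N \<beta> h p) {xs. sqrt (real N) * (cw_mag xs - m) \<le> y})
    \<longlonglongrightarrow> (\<integral>t. normal_density 0 (1 / sqrt curvature) t * indicator {..y} t \<partial>lborel)"
proof -
  have sd: "0 < 1 / sqrt curvature" using curvature_pos by simp
  have "(\<lambda>N. (\<Sum>xs\<in>cw_conf N. cw_weight N \<beta> (h + 0 / sqrt (real N)) p xs * indicator {..y} (sqrt (real N) * (cw_mag xs - m)))
      / (\<Sum>xs\<in>cw_conf N. cw_weight N \<beta> (h + 0 / sqrt (real N)) p xs))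
    \<longlonglongrightarrow> (\<integral>t. normal_density (0 / curvature) (1 / sqrt curvature) t * indicator {..y} t \<partial>lborel)"
  \<comment> \<open>Field shift \<open>s = 0\<close>; the indicator jumps only at
    \<open>y\<close>.\<close>
  proof (rule expectation_ratio_tendsto[where D = "{y}"])
    show "isCont (indicator {..y} :: real \<Rightarrow> real) t" if "t \<notin> {y}" for t
      using that isCont_indicator[of t "{..y}"] by (simp add: frontier_def)
    show "integrable lborel (\<lambda>t. normal_density (0 / curvature) (1 / sqrt curvature) t * indicator {..y} t)"
      using sd by (intro integrable_real_mult_indicator) auto
  qed (auto simp: indicator_def)
  moreover have "measure_pmf.prob (cw_pmf N \<beta> h p) {xs. sqrt (real N) * (cw_mag xs - m) \<le> y}
    = (\<Sum>xs\<in>cw_conf N. cw_weight N \<beta> h p xs * indicator {..y} (sqrt (real N) * (cw_mag xs - m)))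
      / (\<Sum>xs\<in>cw_conf N. cw_weight N \<beta> h p xs)" for N
  proof -
    have "measure_pmf.prob (cw_pmf N \<beta> h p) {xs. sqrt (real N) * (cw_mag xs - m) \<le> y}
      = measure_pmf.expectation (cw_pmf N \<beta> h p) (indicator {xs. sqrt (real N) * (cw_mag xs - m) \<le> y})"
      by simp
    also have "\<dots> = (\<Sum>xs\<in>cw_conf N. pmf (cw_pmf N \<beta> h p) xs *\<^sub>R indicator {xs. sqrt (real N) * (cw_mag xs - m) \<le> y} xs)"
      by (intro integral_measure_pmf) (auto simp: set_pmf_iff pmf_cw_pmf split: if_splits)
    also have "\<dots> = (\<Sum>xs\<in>cw_conf N. cw_weight N \<beta> h p xs * indicator {..y} (sqrt (real N) * (cw_mag xs - m))
       / (\<Sum>xs\<in>cw_conf N. cw_weight N \<beta> h p xs))"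
      by (intro sum.cong) (auto simp: pmf_cw_pmf indicator_def)
    finally show ?thesis unfolding sum_divide_distrib .
  qed
  ultimately show ?thesis by simp
qed

end

text \<open>The threshold varies with \<open>n\<close>, so pointwise convergence must be
  strengthened. Monotonicity squeezes \<open>F n (Y n)\<close> between the values at two fixed
  points near \<open>y\<close>, where \<open>G\<close> is close to \<open>G y\<close>.\<close>

lemma tendsto_mono_compose:
  fixes F :: "nat \<Rightarrow> real \<Rightarrow> real" and G :: "real \<Rightarrow> real"
  assumes mono: "\<And>n. mono (F n)" and lim: "\<And>y. (\<lambda>n. F n y) \<longlonglongrightarrow> G y"
    and cont: "isCont G y" and Y: "Y \<longlonglongrightarrow> y"
  shows "(\<lambda>n. F n (Y n)) \<longlonglongrightarrow> G y"
proof (rule LIMSEQ_I)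
  fix r :: real assume r: "r > 0"
  obtain d where d: "d > 0" "\<And>z. \<bar>z - y\<bar> < d \<Longrightarrow> \<bar>G z - G y\<bar> < r / 2"
    using cont r unfolding continuous_at_eps_delta by (metis half_gt_zero dist_real_def)
  have near: "\<bar>G (y + d / 2) - G y\<bar> < r / 2" "\<bar>G (y - d / 2) - G y\<bar> < r / 2"
    using d by auto
  have "\<forall>\<^sub>F n in sequentially. \<bar>F n (y + d / 2) - G (y + d / 2)\<bar> < r / 2"
    "\<forall>\<^sub>F n in sequentially. \<bar>F n (y - d / 2) - G (y - d / 2)\<bar> < r / 2"
    "\<forall>\<^sub>F n in sequentially. \<bar>Y n - y\<bar> < d / 2"
    using tendstoD[OF lim, of "r / 2"] tendstoD[OF Y, of "d / 2"] r d(1) by (auto simp: dist_real_def)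
  then have "\<forall>\<^sub>F n in sequentially. norm (F n (Y n) - G y) < r"
  proof (eventually_elim)
    case (elim n)
    have "y - d / 2 \<le> Y n" "Y n \<le> y + d / 2"
      using elim(3) by linarith+
    then have "F n (y - d / 2) \<le> F n (Y n)" "F n (Y n) \<le> F n (y + d / 2)"
      by (auto intro: monoD[OF mono])
    then show ?case
      using elim(1,2) near unfolding real_norm_def by linarith
  qed
  then show "\<exists>no. \<forall>n\<ge>no. norm (F n (Y n) - G y) < r"
    by (simp add: eventually_sequentially)
qed

section \<open>Normal distribution functions and the transfer to the estimate\<close>

lemma cdf_normal_eq_integral:
  assumes "\<sigma> > 0"
  shows "cdf (density lborel (normal_density \<mu> \<sigma>)) y = (\<integral>t. normal_density \<mu> \<sigma> t * indicator {..y} t \<partial>lborel)"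
proof -
  have "cdf (density lborel (normal_density \<mu> \<sigma>)) y
    = (\<integral>t. indicator {..y} t \<partial>density lborel (normal_density \<mu> \<sigma>))"
    by (simp add: cdf_def)
  also have "\<dots> = (\<integral>t. normal_density \<mu> \<sigma> t * indicator {..y} t \<partial>lborel)"
    by (subst integral_density) auto
  finally show ?thesis .
qed

lemma isCont_cdf_normal:
  assumes "\<sigma> > 0"
  shows "isCont (cdf (density lborel (normal_density \<mu> \<sigma>))) y"
proof -
  interpret prob_space "density lborel (normal_density \<mu> \<sigma>)"
    by (rule prob_space_normal_density[OF assms])
  interpret real_distribution "density lborel (normal_density \<mu> \<sigma>)"
    by standard auto
  have "AE t in density lborel (normal_density \<mu> \<sigma>). t \<notin> {y}"
    using AE_lborel_singleton[of y] by (subst AE_density) auto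
  then have "prob {y} = 0"
    by (subst prob_eq_0) auto
  then show ?thesis
    by (simp add: isCont_cdf)
qed

lemma cdf_normal_scale:
  assumes "a > 0"
  shows "cdf (density lborel (normal_density 0 (1 / sqrt a))) (x / a) = cdf (density lborel (normal_density 0 (sqrt a))) x"
proof -
  \<comment> \<open>The substitution \<open>t = a * u\<close> turns variance \<open>a\<close> into
    \<open>a / a\<^sup>2 = 1 / a\<close>.\<close>
  have dens: "a * normal_density 0 (sqrt a) (a * u) = normal_density 0 (1 / sqrt a) u" for u
  proof -
    have "(a * u)\<^sup>2 / (2 * a) = u\<^sup>2 / (2 * (1 / a))"
      using assms by (simp add: power2_eq_square)
    moreover have "a / sqrt (2 * pi * a) = 1 / sqrt (2 * pi * (1 / a))"
    proof -
      have "a / sqrt (2 * pi * a) = (a / sqrt a) / sqrt (2 * pi)"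
        by (simp add: real_sqrt_mult)
      also have "\<dots> = sqrt a / sqrt (2 * pi)"
        using assms by (simp add: real_div_sqrt)
      also have "\<dots> = 1 / sqrt (2 * pi / a)"
        by (simp only: real_sqrt_divide) simp
      finally show ?thesis by simp
    qed
    ultimately have "a / sqrt (2 * pi * a) * exp (- ((a * u)\<^sup>2 / (2 * a)))
      = 1 / sqrt (2 * pi * (1 / a)) * exp (- (u\<^sup>2 / (2 * (1 / a))))"
      by (simp only:)
    then show ?thesis
      using assms unfolding normal_density_def by (simp add: power_divide)
  qed
  have "(\<integral>t. normal_density 0 (sqrt a) t * indicator {..x} t \<partial>lborel)
    = a * (\<integral>u. normal_density 0 (sqrt a) (a * u) * indicator {..x} (a * u) \<partial>lborel)"
    using assms lborel_integral_real_affine[of a "\<lambda>t. normal_density 0 (sqrt a) t * indicator {..x} t" 0] by simp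
  also have "\<dots> = (\<integral>u. (a * normal_density 0 (sqrt a) (a * u)) * indicator {..x} (a * u) \<partial>lborel)"
    by (simp add: mult.assoc)
  also have "\<dots> = (\<integral>u. normal_density 0 (1 / sqrt a) u * indicator {..x / a} u \<partial>lborel)"
    unfolding dens using assms by (intro Bochner_Integration.integral_cong) (auto simp: indicator_def field_simps)
  finally show ?thesis
    using assms by (simp add: cdf_normal_eq_integral)
qed

lemma (in cw_critical) cw_mle_clt:
  "(\<lambda>N. measure_pmf.prob (cw_pmf N \<beta> h p) {xs. ereal (sqrt (real N)) * (cw_mle N \<beta> p xs - ereal h) \<le> ereal x})
    \<longlonglongrightarrow> cdf (density lborel (normal_density 0 (sqrt curvature))) x"
proof -
  define F where "F N y = measure_pmf.prob (cw_pmf N \<beta> h p) {xs. sqrt (real N) * (cw_mag xs - m) \<le> y}" for N y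
  \<comment> \<open>The deterministic threshold for \<open>W\<close> that represents the event about
    the estimate; it tends to \<open>x / curvature\<close>.\<close>
  define Y where "Y N = sqrt (real N) * (cw_mean N \<beta> (h + x / sqrt (real N)) p - m)" for N
  have sd: "0 < 1 / sqrt curvature" using curvature_pos by simp
  have "(\<lambda>N. F N (Y N)) \<longlonglongrightarrow> cdf (density lborel (normal_density 0 (1 / sqrt curvature))) (x / curvature)"
  proof (rule tendsto_mono_compose[where F = F and G = "cdf (density lborel (normal_density 0 (1 / sqrt curvature)))"])
    show "mono (F N)" for N
      unfolding F_def by (intro monoI measure_pmf.finite_measure_mono) auto
    show "(\<lambda>N. F N y) \<longlonglongrightarrow> cdf (density lborel (normal_density 0 (1 / sqrt curvature))) y" for y
      unfolding F_def cdf_normal_eq_integral[OF sd] by (rule cw_mag_clt)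
    show "Y \<longlonglongrightarrow> x / curvature"
      unfolding Y_def by (rule cw_mean_tendsto)
    show "isCont (cdf (density lborel (normal_density 0 (1 / sqrt curvature)))) (x / curvature)"
      by (rule isCont_cdf_normal[OF sd])
  qed
  then have "(\<lambda>N. F N (Y N)) \<longlonglongrightarrow> cdf (density lborel (normal_density 0 (sqrt curvature))) x"
    by (simp only: cdf_normal_scale[OF curvature_pos])
  moreover have "\<forall>\<^sub>F N in sequentially. F N (Y N) =
    measure_pmf.prob (cw_pmf N \<beta> h p) {xs. ereal (sqrt (real N)) * (cw_mle N \<beta> p xs - ereal h) \<le> ereal x}"
    using eventually_gt_at_top[of 0]
  proof eventually_elim
    case (elim N)
    show ?case
      unfolding F_def
    proof (rule measure_pmf.finite_measure_eq_AE)
      show "AE xs in measure_pmf (cw_pmf N \<beta> h p). xs \<in> {xs. sqrt (real N) * (cw_mag xs - m) \<le> Y N}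
        \<longleftrightarrow> xs \<in> {xs. ereal (sqrt (real N)) * (cw_mle N \<beta> p xs - ereal h) \<le> ereal x}"
      proof (rule AE_pmfI)
        fix xs assume "xs \<in> set_pmf (cw_pmf N \<beta> h p)"
        then have "xs \<in> cw_conf N" by (auto simp: set_pmf_iff pmf_cw_pmf split: if_splits)
        then show "xs \<in> {xs. sqrt (real N) * (cw_mag xs - m) \<le> Y N}
          \<longleftrightarrow> xs \<in> {xs. ereal (sqrt (real N)) * (cw_mle N \<beta> p xs - ereal h) \<le> ereal x}"
          using elim by (simp add: scaled_cw_mle_le_iff Y_def)
      qed
    qed auto
  qed
  ultimately show ?thesis
    by (rule Lim_transform_eventually)
qed

theorem mainTheorem3:
  fixes \<beta> h m :: real and p :: nat
  assumes "p \<ge> 3" and "\<beta> \<ge> 0"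
    and "cw_regular \<beta> h p"
    and "m \<in> {-1..1}" and "\<forall>x\<in>{-1..1}. cw_H \<beta> h p x \<le> cw_H \<beta> h p m"
  shows "\<forall>x::real. (\<lambda>N. measure (measure_pmf (cw_pmf N \<beta> h p))
            {xs. ereal (sqrt (real N)) * (cw_mle N \<beta> p xs - ereal h) \<le> ereal x})
          \<longlonglongrightarrow> cdf (density lborel (normal_density 0 (sqrt (- deriv (deriv (cw_H \<beta> h p)) m)))) x"
proof -
  obtain m0 where m0: "m0 \<in> {-1<..<1}" "\<And>x. x \<in> {-1..1} \<Longrightarrow> x \<noteq> m0 \<Longrightarrow> cw_H \<beta> h p x < cw_H \<beta> h p m0"
    "deriv (deriv (cw_H \<beta> h p)) m0 < 0"
    using assms(3) unfolding cw_regular_def by blast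
  have "cw_H \<beta> h p m0 \<le> cw_H \<beta> h p m" using assms(5) m0(1) by simp
  \<comment> \<open>The given maximiser cannot be strictly below \<open>m0\<close>, so it inherits
    interiority and the second derivative condition.\<close>
  then have "m = m0" using m0(2)[OF assms(4)] by fastforce
  then have m: "\<bar>m\<bar> < 1" using m0(1) by (auto simp: abs_less_iff)
  have "\<beta> * (real p * m ^ (p - 1)) + h - artanh m = 0"
  proof (rule DERIV_local_max[OF has_real_derivative_cw_H[OF m]])
    \<comment> \<open>This radius keeps the neighbourhood of \<open>m\<close> inside
      \<open>{-1..1}\<close>, where \<open>m\<close> is known to be maximal.\<close>
    show "0 < 1 - \<bar>m\<bar>" using m by simp
    show "\<forall>y. \<bar>m - y\<bar> < 1 - \<bar>m\<bar> \<longrightarrow> cw_H \<beta> h p y \<le> cw_H \<beta> h p m"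
    proof (intro allI impI)
      fix y assume "\<bar>m - y\<bar> < 1 - \<bar>m\<bar>"
      then have "y \<in> {-1..1}" unfolding atLeastAtMost_iff by linarith
      then show "cw_H \<beta> h p y \<le> cw_H \<beta> h p m" using assms(5) by blast
    qed
  qed
  then interpret cw_critical \<beta> h m p
    using m m0(2,3) \<open>m = m0\<close> by unfold_locales auto
  show ?thesis
    unfolding curvature_eq[symmetric] by (intro allI cw_mle_clt)
qed

end
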